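(* Consider a two-node repeater $A-N_1-N_2-B$ in which segment $S_1=(A,N_1)$ shares $|\psi(\alpha'_l)\rangle=\sqrt{\alpha'_l}|00\rangle+\sqrt{1-\alpha'_l}|11\rangle$, segment $S_2=(N_1,N_2)$ shares $\rho(p,\delta)=p|01\rangle\langle01|+(1-p)|\zeta_\delta\rangle\langle\zeta_\delta|$ with $|\zeta_\delta\rangle=\sqrt\delta|00\rangle+\sqrt{1-\delta}|11\rangle$, and segment $S_3=(N_2,B)$ shares $|\psi(\alpha'_r)\rangle=\sqrt{\alpha'_r}|00\rangle+\sqrt{1-\alpha'_r}|11\rangle$, where $p\in(0,1)$, $\delta\in[1/2,1)$, $\alpha'_l,\alpha'_r\in[1/2,1)$. If $$\frac{\alpha'_l\alpha'_r}{(1-\alpha'_l)(1-\alpha'_r)}\le\frac{p^2}{\delta(1-\delta)(1-p)^2},$$ then the LOCC protocol in which $N_2$ and then $N_1$ each perform a Bell-basis measurement on their two qubits, followed by optimal two-party LOCC by $A$ and $B$ on each resulting conditional state, achieves average fully entangled fraction $F^\star(\rho(p,\delta))$; hence $F^\star_{AB}=F^\star(\rho(p,\delta))$.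
   Context: Bell basis: $(|00\rangle\pm|11\rangle)/\sqrt2$, $(|01\rangle\pm|10\rangle)/\sqrt2$. For a two-qubit state $X$, $F(X)=\max_{|\phi\rangle}\langle\phi|X|\phi\rangle$ over two-qubit maximally entangled states; $F^\star(\rho)=\max_\Lambda F(\Lambda(\rho))$ over trace-preserving two-party LOCC maps. In a repeater with parties $A,N_1,\dots,N_n,B$ and consecutive segments each holding a two-qubit state, $F^\star_{AB}$ is the supremum over LOCC protocols among all parties ending with $AB$ state $\sigma_k$ with probability $q_k$ (outcome known to all) of $\sum_k q_kF(\sigma_k)$. One has $F^\star(\rho(p,\delta))=\frac12(1+\mathcal{C}-p)$ if $\mathcal{C}>2p$ and $\frac12(1+\mathcal{C}^2/(4p))$ if $\mathcal{C}\le2p$, where $\mathcal{C}=2\sqrt{\delta(1-\delta)}(1-p)$. *)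

theory Defs
  imports Complex_Main
begin

text \<open>A system of parties 0,...,m-1 with local dimensions ds (a list of length m).
  A global basis index is a function i :: nat => nat with i j < ds!j for j < m
  (and i j = 0 for j >= m).  An (unnormalised) operator is a function of two
  global indices; only its values on idx ds matter.\<close>

type_synonym gop = "(nat \<Rightarrow> nat) \<Rightarrow> (nat \<Rightarrow> nat) \<Rightarrow> complex"

definition idx :: "nat list \<Rightarrow> (nat \<Rightarrow> nat) set" where
  "idx ds = {i. (\<forall>j<length ds. i j < ds ! j) \<and> (\<forall>j\<ge>length ds. i j = 0)}"

text \<open>Kraus operator K (a d_out x d_in matrix, K b a) applied locally by party j:
  X \<mapsto> (I \<otimes> K \<otimes> I) X (I \<otimes> K \<otimes> I)^dagger.\<close>
definition apply_local :: "nat list \<Rightarrow> nat \<Rightarrow> (nat \<Rightarrow> nat \<Rightarrow> complex) \<Rightarrow> gop \<Rightarrow> gop" where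
  "apply_local ds j K X = (\<lambda>i i'.
     (\<Sum>a<ds ! j. \<Sum>a'<ds ! j. K (i j) a * X (i(j := a)) (i'(j := a')) * cnj (K (i' j) a')))"

text \<open>A (finite-round) LOCC protocol tree.  At a node, party j performs a local
  instrument; each outcome is given by (output dimension d, list of Kraus operators,
  continuation protocol).  The outcome is broadcast to everybody (tree structure).\<close>
datatype protocol = Stop | Step nat "(nat \<times> (nat \<Rightarrow> nat \<Rightarrow> complex) list \<times> protocol) list"

definition trace_pres :: "nat \<Rightarrow> (nat \<times> (nat \<Rightarrow> nat \<Rightarrow> complex) list \<times> protocol) list \<Rightarrow> bool" where
  "trace_pres din outs = (\<forall>a<din. \<forall>a'<din.
     sum_list (map (\<lambda>(d, Ks, Q). sum_list (map (\<lambda>K. \<Sum>b<d. cnj (K b a) * K b a') Ks)) outs)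
       = (if a = a' then 1 else 0))"

fun valid :: "(nat list \<Rightarrow> bool) \<Rightarrow> protocol \<Rightarrow> nat list \<Rightarrow> bool" where
  "valid ok Stop ds = ok ds"
| "valid ok (Step j outs) ds =
     (j < length ds \<and> trace_pres (ds ! j) outs \<and>
      (\<forall>x\<in>set outs. valid ok (snd (snd x)) (ds[j := fst x])))"

fun pval :: "(nat list \<Rightarrow> gop \<Rightarrow> real) \<Rightarrow> protocol \<Rightarrow> nat list \<Rightarrow> gop \<Rightarrow> real" where
  "pval g Stop ds X = g ds X"
| "pval g (Step j outs) ds X =
     sum_list (map (\<lambda>x. pval g (snd (snd x)) (ds[j := fst x])
        (\<lambda>i i'. sum_list (map (\<lambda>K. apply_local ds j K X i i') (fst (snd x))))) outs)"

definition ix2 :: "nat \<Rightarrow> nat \<Rightarrow> nat \<Rightarrow> nat" where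
  "ix2 a b = (\<lambda>j. if j = 0 then a else if j = 1 then b else 0)"

definition max_ent :: "(nat \<Rightarrow> nat \<Rightarrow> complex) \<Rightarrow> bool" where
  "max_ent \<phi> = (\<forall>a<2. \<forall>a'<2. (\<Sum>b<2. \<phi> a b * cnj (\<phi> a' b)) = (if a = a' then 1/2 else 0))"

definition FEF :: "gop \<Rightarrow> real" where
  "FEF X = Sup {Re (\<Sum>a<2. \<Sum>b<2. \<Sum>a'<2. \<Sum>b'<2.
                      cnj (\<phi> a b) * X (ix2 a b) (ix2 a' b') * \<phi> a' b') | \<phi>. max_ent \<phi>}"

text \<open>F*(X): supremum over trace-preserving two-party LOCC maps of F of the output;
  since F is positively homogeneous, F of the averaged branches equals
  sum_k q_k F(sigma_k) with unnormalised branches summed.\<close>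
definition Fstar :: "gop \<Rightarrow> real" where
  "Fstar X = Sup {pval (\<lambda>ds Y. FEF Y) P [2, 2] X | P. valid (\<lambda>ds. ds = [2, 2]) P [2, 2]}"

text \<open>Parties 0 = A (1 qubit), 1 = N1 (2 qubits, local index 2*q_S1 + q_S2),
  2 = N2 (2 qubits, local index 2*q_S2 + q_S3), 3 = B (1 qubit).\<close>

definition psi_st :: "real \<Rightarrow> nat \<Rightarrow> nat \<Rightarrow> complex" where
  "psi_st \<alpha> x y = (if x = 0 \<and> y = 0 then complex_of_real (sqrt \<alpha>)
                    else if x = 1 \<and> y = 1 then complex_of_real (sqrt (1 - \<alpha>)) else 0)"

definition rho_pd :: "real \<Rightarrow> real \<Rightarrow> nat \<Rightarrow> nat \<Rightarrow> nat \<Rightarrow> nat \<Rightarrow> complex" where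
  "rho_pd p \<delta> x y x' y' =
     (if x = 0 \<and> y = 1 \<and> x' = 0 \<and> y' = 1 then complex_of_real p else 0)
     + complex_of_real (1 - p) * psi_st \<delta> x y * cnj (psi_st \<delta> x' y')"

definition rho_op :: "real \<Rightarrow> real \<Rightarrow> gop" where
  "rho_op p \<delta> = (\<lambda>i i'. rho_pd p \<delta> (i 0) (i 1) (i' 0) (i' 1))"

definition rep_init :: "real \<Rightarrow> real \<Rightarrow> real \<Rightarrow> real \<Rightarrow> gop" where
  "rep_init al p \<delta> ar = (\<lambda>i i'.
     psi_st al (i 0) (i 1 div 2) * cnj (psi_st al (i' 0) (i' 1 div 2))
     * rho_pd p \<delta> (i 1 mod 2) (i 2 div 2) (i' 1 mod 2) (i' 2 div 2)
     * psi_st ar (i 2 mod 2) (i 3) * cnj (psi_st ar (i' 2 mod 2) (i' 3)))"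

definition ix4 :: "nat \<Rightarrow> nat \<Rightarrow> nat \<Rightarrow> nat \<Rightarrow> nat \<Rightarrow> nat" where
  "ix4 a c e b = (\<lambda>j. if j = 0 then a else if j = 1 then c else if j = 2 then e
                      else if j = 3 then b else 0)"

definition rep_ok :: "nat list \<Rightarrow> bool" where
  "rep_ok ds = (length ds = 4 \<and> ds ! 0 = 2 \<and> ds ! 3 = 2)"

definition reduce_AB :: "nat list \<Rightarrow> gop \<Rightarrow> gop" where
  "reduce_AB ds X = (\<lambda>i i'. \<Sum>c<ds ! 1. \<Sum>e<ds ! 2. X (ix4 (i 0) c e (i 1)) (ix4 (i' 0) c e (i' 1)))"

definition Fstar_AB :: "gop \<Rightarrow> real" where
  "Fstar_AB X = Sup {pval (\<lambda>ds Y. FEF (reduce_AB ds Y)) P [2, 4, 4, 2] X | P. valid rep_ok P [2, 4, 4, 2]}"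

text \<open>Bell basis vectors on a 2-qubit local index c = 2x + y:
  0: (|00>+|11>)/sqrt2, 1: (|00>-|11>)/sqrt2, 2: (|01>+|10>)/sqrt2, 3: (|01>-|10>)/sqrt2.\<close>
definition bell :: "nat \<Rightarrow> nat \<Rightarrow> complex" where
  "bell k c = complex_of_real (1 / sqrt 2) *
     (if k = 0 then (if c = 0 then 1 else if c = 3 then 1 else 0)
      else if k = 1 then (if c = 0 then 1 else if c = 3 then -1 else 0)
      else if k = 2 then (if c = 1 then 1 else if c = 2 then 1 else 0)
      else (if c = 1 then 1 else if c = 2 then -1 else 0))"

text \<open>Unnormalised conditional AB state (q_k sigma_k) after N2 obtains Bell outcome k2 and
  N1 obtains Bell outcome k1, as a two-qubit operator.\<close>
definition cond_AB :: "gop \<Rightarrow> nat \<Rightarrow> nat \<Rightarrow> gop" where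
  "cond_AB X k1 k2 = (\<lambda>i i'. \<Sum>c<4. \<Sum>c'<4. \<Sum>e<4. \<Sum>e'<4.
      cnj (bell k1 c) * cnj (bell k2 e) * X (ix4 (i 0) c e (i 1)) (ix4 (i' 0) c' e' (i' 1))
      * bell k1 c' * bell k2 e')"

end

theory Submission
  imports Defs
begin

text \<open>
  Upper bound: adding the positive operator with weight \<open>\<alpha>\<^sup>2\<beta>\<^sup>2/\<omega>\<^sup>2\<close> on the missing anticorrelated
  basis vector turns \<open>|\<xi>\<rangle>\<langle>\<xi>| + \<omega>\<^sup>2|01\<rangle>\<langle>01|\<close>, \<open>\<xi> = \<alpha>|00\<rangle> + \<beta>|11\<rangle>\<close>, into a mixture of four
  product vectors. LOCC maps product vectors to product vectors and preserves their total weight,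
  and a product vector has overlap at most \<open>1/2\<close> with a maximally entangled one, so no protocol
  exceeds half the enlarged trace. For the repeater the same decomposition is used across the cut
  \<open>A N\<^sub>1 | N\<^sub>2 B\<close>, where the two pure segments are local ancillas.

  Lower bound: A damps the level \<open>|0\<rangle>\<close> by \<open>t = \<alpha>\<beta>/\<omega>\<^sup>2\<close>; if this filter fails, A is left in \<open>|0\<rangle>\<close>
  and B resets to \<open>|0\<rangle>\<close>. This attains the upper bound whenever \<open>\<bar>t\<bar> \<le> 1\<close>. After Bell outcomes
  \<open>k\<^sub>1, k\<^sub>2\<close> the conditional state has the same form with rescaled amplitudes; the hypothesis
  on \<open>\<alpha>'\<^sub>l, \<alpha>'\<^sub>r\<close> says exactly that \<open>\<bar>t\<bar> \<le> 1\<close> for each outcome, and the optimal values add up to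
  that of \<open>\<rho>(p,\<delta>)\<close>.
\<close>

section \<open>Operators as finite sums of rank-one terms\<close>

definition opsum :: "((nat \<Rightarrow> nat) \<Rightarrow> complex) list \<Rightarrow> gop" where
  "opsum L = (\<lambda>i i'. \<Sum>u\<leftarrow>L. u i * cnj (u i'))"

definition kvec :: "nat list \<Rightarrow> nat \<Rightarrow> (nat \<Rightarrow> nat \<Rightarrow> complex) \<Rightarrow> ((nat \<Rightarrow> nat) \<Rightarrow> complex) \<Rightarrow> (nat \<Rightarrow> nat) \<Rightarrow> complex" where
  "kvec ds j K u = (\<lambda>i. \<Sum>a<ds ! j. K (i j) a * u (i(j := a)))"

definition sqn :: "nat list \<Rightarrow> ((nat \<Rightarrow> nat) \<Rightarrow> complex) \<Rightarrow> real" where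
  "sqn ds u = (\<Sum>i\<in>idx ds. (cmod (u i))\<^sup>2)"

text \<open>The parties in \<open>S\<close> form one side of the bipartition; no normalisation is imposed.\<close>
definition bipartite_product :: "nat set \<Rightarrow> ((nat \<Rightarrow> nat) \<Rightarrow> complex) \<Rightarrow> bool" where
  "bipartite_product S u = (\<exists>E G. u = (\<lambda>i. E i * G i)
     \<and> (\<forall>i j a. j \<in> S \<longrightarrow> G (i(j := a)) = G i) \<and> (\<forall>i j a. j \<notin> S \<longrightarrow> E (i(j := a)) = E i))"

definition fid :: "(nat \<Rightarrow> nat \<Rightarrow> complex) \<Rightarrow> gop \<Rightarrow> real" where
  "fid \<phi> X = Re (\<Sum>a<2. \<Sum>b<2. \<Sum>a'<2. \<Sum>b'<2.
                      cnj (\<phi> a b) * X (ix2 a b) (ix2 a' b') * \<phi> a' b')"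

lemma FEF_fid: "FEF X = Sup {fid \<phi> X | \<phi>. max_ent \<phi>}"
  by (simp add: FEF_def fid_def)

section \<open>Local operations on mixtures of product vectors\<close>

text \<open>The operator of party \<open>j\<close> acts only on the factor that depends on
  coordinate \<open>j\<close>; the other factor is constant in that coordinate and leaves the
  sum.\<close>

lemma bipartite_product_kvec:
  assumes "bipartite_product S u"
  shows "bipartite_product S (kvec ds j K u)"
proof -
  from assms obtain E G where u: "u = (\<lambda>i. E i * G i)"
    and G: "\<And>i j a. j \<in> S \<Longrightarrow> G (i(j := a)) = G i"
    and E: "\<And>i j a. j \<notin> S \<Longrightarrow> E (i(j := a)) = E i"
    unfolding bipartite_product_def by blast
  show ?thesis
  proof (cases "j \<in> S")
    case True
    have "kvec ds j K u = (\<lambda>i. kvec ds j K E i * G i)"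
      by (auto simp: kvec_def u G True sum_distrib_right mult.assoc)
    moreover have "kvec ds j K E (i(k := a)) = kvec ds j K E i" if "k \<notin> S" for i k a
      using that True by (auto simp: kvec_def E fun_upd_twist[of k j] intro!: sum.cong)
    ultimately show ?thesis unfolding bipartite_product_def using G by blast
  next
    case False
    have "kvec ds j K u = (\<lambda>i. E i * kvec ds j K G i)"
      by (auto simp: kvec_def u E False sum_distrib_left mult_ac)
    moreover have "kvec ds j K G (i(k := a)) = kvec ds j K G i" if "k \<in> S" for i k a
      using that False by (auto simp: kvec_def G fun_upd_twist[of k j] intro!: sum.cong)
    ultimately show ?thesis unfolding bipartite_product_def using E by blast
  qed
qed

lemma apply_local_proj:
  "apply_local ds j K (\<lambda>i i'. u i * cnj (u i')) = (\<lambda>i i'. kvec ds j K u i * cnj (kvec ds j K u i'))"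
  by (simp add: apply_local_def kvec_def fun_eq_iff sum_product mult_ac)

lemma apply_local_diff:
  "apply_local ds j K (\<lambda>i i'. X i i' - Y i i') =
     (\<lambda>i i'. apply_local ds j K X i i' - apply_local ds j K Y i i')"
  by (simp add: apply_local_def fun_eq_iff algebra_simps sum_subtractf)

lemma apply_local_add:
  "apply_local ds j K (\<lambda>i i'. X i i' + Y i i') =
     (\<lambda>i i'. apply_local ds j K X i i' + apply_local ds j K Y i i')"
  by (simp add: apply_local_def fun_eq_iff algebra_simps sum.distrib)

lemma opsum_Nil: "opsum [] = (\<lambda>i i'. 0)"
  by (simp add: opsum_def)

lemma opsum_Cons: "opsum (u # L) = (\<lambda>i i'. u i * cnj (u i') + opsum L i i')"
  by (simp add: opsum_def)

lemma apply_local_opsum: "apply_local ds j K (opsum L) = opsum (map (kvec ds j K) L)"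
proof (induction L)
  case Nil
  show ?case by (simp add: opsum_Nil apply_local_def)
next
  case (Cons u L)
  then show ?case by (simp add: opsum_Cons apply_local_add apply_local_proj)
qed

text \<open>Minuend and subtrahend evolve separately, so a difference of two positive operators
  keeps this form through a whole protocol tree and the sign matters only at the leaves.\<close>

lemma apply_local_Kraus_list:
  "(\<lambda>i i'. \<Sum>K\<leftarrow>Ks. apply_local ds j K (\<lambda>i i'. opsum L i i' - opsum M i i') i i') =
   (\<lambda>i i'. opsum (concat (map (\<lambda>K. map (kvec ds j K) L) Ks)) i i'
         - opsum (concat (map (\<lambda>K. map (kvec ds j K) M) Ks)) i i')"
proof (intro ext)
  fix i i'
  have "opsum (L1 @ L2) i i' = opsum L1 i i' + opsum L2 i i'" for L1 L2
    by (simp add: opsum_def)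
  then show "(\<Sum>K\<leftarrow>Ks. apply_local ds j K (\<lambda>i i'. opsum L i i' - opsum M i i') i i') =
      opsum (concat (map (\<lambda>K. map (kvec ds j K) L) Ks)) i i'
      - opsum (concat (map (\<lambda>K. map (kvec ds j K) M) Ks)) i i'"
    by (induction Ks) (simp_all add: opsum_Nil apply_local_diff apply_local_opsum algebra_simps)
qed

text \<open>\<open>ds[j := 1]\<close> forces coordinate \<open>j\<close> to be 0 and thus enumerates
  the settings of all other parties, whatever the dimension \<open>d\<close>.\<close>

lemma sum_idx_split:
  assumes "j < length ds"
  shows "(\<Sum>i\<in>idx (ds[j := d]). f i) = (\<Sum>i\<in>idx (ds[j := 1]). \<Sum>b<d. f (i(j := b)))"
proof -
  have "(\<Sum>i\<in>idx (ds[j := d]). f i) = (\<Sum>(i, b)\<in>idx (ds[j := 1]) \<times> {..<d}. f (i(j := b)))"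
    by (rule sum.reindex_bij_witness[where i = "\<lambda>(i, b). i(j := b)" and j = "\<lambda>i. (i(j := 0), i j)"])
      (use assms in \<open>auto simp: idx_def nth_list_update split: if_splits\<close>)
  then show ?thesis by (simp add: sum.cartesian_product)
qed

lemma sum_list_sum_swap:
  fixes f :: "'a \<Rightarrow> 'b \<Rightarrow> 'c::comm_monoid_add"
  shows "(\<Sum>x\<leftarrow>xs. \<Sum>i\<in>A. f x i) = (\<Sum>i\<in>A. \<Sum>x\<leftarrow>xs. f x i)"
  by (induction xs) (auto simp: sum.distrib)

lemma sum_list_swap:
  fixes f :: "'a \<Rightarrow> 'b \<Rightarrow> 'c::comm_monoid_add"
  shows "(\<Sum>x\<leftarrow>xs. \<Sum>y\<leftarrow>ys. f x y) = (\<Sum>y\<leftarrow>ys. \<Sum>x\<leftarrow>xs. f x y)"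
  by (induction xs) (auto simp: sum_list_addf)

lemma sum_list_map_concat:
  fixes f :: "'a \<Rightarrow> 'b::comm_monoid_add"
  shows "(\<Sum>x\<leftarrow>concat xss. f x) = (\<Sum>xs\<leftarrow>xss. \<Sum>x\<leftarrow>xs. f x)"
  by (induction xss) auto

lemma sum_rotate: "(\<Sum>b\<in>B. \<Sum>a\<in>A. \<Sum>a'\<in>A'. f b a a') = (\<Sum>a\<in>A. \<Sum>a'\<in>A'. \<Sum>b\<in>B. f b a a')"
  by (rule trans[OF sum.swap]) (intro sum.cong refl sum.swap)

text \<open>Expanding the squares and moving the sums over outcomes inside puts the completeness
  relation of the Kraus operators between two copies of \<open>v\<close>.\<close>

lemma trace_pres_norm:
  assumes "trace_pres n outs"
  shows "(\<Sum>x\<leftarrow>outs. \<Sum>K\<leftarrow>fst (snd x). \<Sum>b<fst x. (cmod (\<Sum>a<n. K b a * v a))\<^sup>2)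
       = (\<Sum>a<n. (cmod (v a))\<^sup>2)"
proof -
  have sq: "complex_of_real ((cmod z)\<^sup>2) = cnj z * z" for z
    by (simp only: complex_norm_square mult.commute)
  have orl: "complex_of_real (sum_list xs) = sum_list (map complex_of_real xs)" for xs
    by (induction xs) auto
  have tp: "(\<Sum>x\<leftarrow>outs. \<Sum>K\<leftarrow>fst (snd x). \<Sum>b<fst x. cnj (K b a) * K b a') = (if a = a' then 1 else 0)"
    if "a < n" "a' < n" for a a'
    using assms that unfolding trace_pres_def case_prod_unfold by blast
  have "complex_of_real (\<Sum>x\<leftarrow>outs. \<Sum>K\<leftarrow>fst (snd x). \<Sum>b<fst x. (cmod (\<Sum>a<n. K b a * v a))\<^sup>2)
      = (\<Sum>x\<leftarrow>outs. \<Sum>K\<leftarrow>fst (snd x). \<Sum>b<fst x. cnj (\<Sum>a<n. K b a * v a) * (\<Sum>a<n. K b a * v a))"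
    by (simp add: orl comp_def sq del: of_real_power cnj_sum)
  also have "\<dots> = (\<Sum>x\<leftarrow>outs. \<Sum>K\<leftarrow>fst (snd x). \<Sum>b<fst x. \<Sum>a<n. \<Sum>a'<n. cnj (v a) * v a' * (cnj (K b a) * K b a'))"
    unfolding cnj_sum sum_product by (simp add: mult_ac)
  also have "\<dots> = (\<Sum>x\<leftarrow>outs. \<Sum>K\<leftarrow>fst (snd x). \<Sum>a<n. \<Sum>a'<n. cnj (v a) * v a' * (\<Sum>b<fst x. cnj (K b a) * K b a'))"
    unfolding sum_distrib_left by (intro arg_cong[where f = sum_list] map_cong refl sum_rotate)
  also have "\<dots> = (\<Sum>a<n. \<Sum>a'<n. cnj (v a) * v a' * (\<Sum>x\<leftarrow>outs. \<Sum>K\<leftarrow>fst (snd x). \<Sum>b<fst x. cnj (K b a) * K b a'))"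
    by (simp add: sum_list_sum_swap sum_list_const_mult)
  also have "\<dots> = (\<Sum>a<n. \<Sum>a'<n. cnj (v a) * v a' * (if a = a' then 1 else 0))"
    by (intro sum.cong refl) (simp add: tp)
  also have "\<dots> = complex_of_real (\<Sum>a<n. (cmod (v a))\<^sup>2)"
    unfolding of_real_sum sq
  proof (intro sum.cong refl)
    fix a assume "a \<in> {..<n}"
    moreover have "(\<Sum>a'<n. cnj (v a) * v a' * (if a = a' then 1 else 0)) = (\<Sum>a'<n. if a = a' then cnj (v a) * v a' else 0)"
      by (intro sum.cong) auto
    ultimately show "(\<Sum>a'<n. cnj (v a) * v a' * (if a = a' then 1 else 0)) = cnj (v a) * v a"
      by simp
  qed
  finally show ?thesis by (simp only: of_real_eq_iff)
qed

lemma trace_pres_sqn: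
  assumes "j < length ds" "trace_pres (ds ! j) outs"
  shows "(\<Sum>x\<leftarrow>outs. \<Sum>K\<leftarrow>fst (snd x). sqn (ds[j := fst x]) (kvec ds j K u)) = sqn ds u"
proof -
  have "sqn (ds[j := d]) (kvec ds j K u) =
      (\<Sum>i\<in>idx (ds[j := 1]). \<Sum>b<d. (cmod (\<Sum>a<ds ! j. K b a * u (i(j := a))))\<^sup>2)" for d K
    unfolding sqn_def by (subst sum_idx_split[OF assms(1)]) (simp add: kvec_def)
  then have "(\<Sum>x\<leftarrow>outs. \<Sum>K\<leftarrow>fst (snd x). sqn (ds[j := fst x]) (kvec ds j K u))
    = (\<Sum>i\<in>idx (ds[j := 1]). \<Sum>x\<leftarrow>outs. \<Sum>K\<leftarrow>fst (snd x). \<Sum>b<fst x.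
         (cmod (\<Sum>a<ds ! j. K b a * u (i(j := a))))\<^sup>2)"
    by (simp add: sum_list_sum_swap)
  also have "\<dots> = (\<Sum>i\<in>idx (ds[j := 1]). \<Sum>a<ds ! j. (cmod (u (i(j := a))))\<^sup>2)"
    by (intro sum.cong refl trace_pres_norm assms(2))
  also have "\<dots> = sqn ds u"
    using sum_idx_split[OF assms(1), of "\<lambda>i. (cmod (u i))\<^sup>2" "ds ! j"] by (simp add: sqn_def)
  finally show ?thesis .
qed

text \<open>A bound at the leaves travels to the root because product vectors stay product and their
  weight, totalled over all branches, is conserved. \<open>M\<close> is carried along; discarding it
  is left to the leaf bound. \<open>ok\<close>, \<open>g\<close> and \<open>S\<close> stay abstract
  to serve both \<open>Fstar\<close> and \<open>Fstar_AB\<close>.\<close>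

lemma pval_le_half_sqn:
  assumes leaf: "\<And>ds L M. ok ds \<Longrightarrow> \<forall>u\<in>set L. bipartite_product S u \<Longrightarrow>
      g ds (\<lambda>i i'. opsum L i i' - opsum M i i') \<le> 1/2 * (\<Sum>u\<leftarrow>L. sqn ds u)"
  shows "valid ok P ds \<Longrightarrow> \<forall>u\<in>set L. bipartite_product S u \<Longrightarrow>
      pval g P ds (\<lambda>i i'. opsum L i i' - opsum M i i') \<le> 1/2 * (\<Sum>u\<leftarrow>L. sqn ds u)"
  using leaf
proof (induction ok P ds arbitrary: L M rule: valid.induct)
  case (1 ok ds)
  then show ?case by simp
next
  case (2 ok j outs ds)
  let ?L = "\<lambda>Ks. concat (map (\<lambda>K. map (kvec ds j K) L) Ks)"
  have v: "j < length ds" "trace_pres (ds ! j) outs"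
    and vx: "\<And>x. x \<in> set outs \<Longrightarrow> valid ok (snd (snd x)) (ds[j := fst x])"
    using "2.prems"(1) by auto
  have "pval g (Step j outs) ds (\<lambda>i i'. opsum L i i' - opsum M i i') \<le>
      (\<Sum>x\<leftarrow>outs. 1/2 * (\<Sum>u\<leftarrow>?L (fst (snd x)). sqn (ds[j := fst x]) u))"
    unfolding pval.simps apply_local_Kraus_list
  proof (rule sum_list_mono)
    fix x assume x: "x \<in> set outs"
    show "pval g (snd (snd x)) (ds[j := fst x])
        (\<lambda>i i'. opsum (?L (fst (snd x))) i i' - opsum (concat (map (\<lambda>K. map (kvec ds j K) M) (fst (snd x)))) i i')
      \<le> 1/2 * (\<Sum>u\<leftarrow>?L (fst (snd x)). sqn (ds[j := fst x]) u)"
      by (rule "2.IH"[OF x vx[OF x] _ "2.prems"(3)])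
        (use "2.prems"(2) in \<open>auto intro: bipartite_product_kvec\<close>)
  qed
  also have "\<dots> = 1/2 * (\<Sum>u\<leftarrow>L. \<Sum>x\<leftarrow>outs. \<Sum>K\<leftarrow>fst (snd x). sqn (ds[j := fst x]) (kvec ds j K u))"
    by (simp only: sum_list_const_mult sum_list_map_concat map_map comp_def sum_list_swap[where ys = L])
  also have "\<dots> = 1/2 * (\<Sum>u\<leftarrow>L. sqn ds u)"
    by (simp add: trace_pres_sqn v)
  finally show ?case .
qed

section \<open>Overlap with maximally entangled states\<close>

text \<open>As a matrix, \<open>\<phi>\<close> is a unitary divided by the square root of 2, so
  contracting \<open>e\<close> with it gives a vector \<open>h\<close> of half the squared norm;
  Cauchy-Schwarz against \<open>f\<close> finishes.\<close>

lemma max_ent_overlap_product: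
  assumes "max_ent \<phi>"
  shows "(cmod (\<Sum>a<2. \<Sum>b<2. cnj (\<phi> a b) * (e a * f b)))\<^sup>2
      \<le> 1/2 * (\<Sum>a<2. \<Sum>b<2. (cmod (e a * f b))\<^sup>2)"
proof -
  define h where "h b = (\<Sum>a<2. cnj (\<phi> a b) * e a)" for b
  have m: "(\<Sum>b<2. \<phi> a b * cnj (\<phi> a' b)) = (if a = a' then 1/2 else 0)" if "a < 2" "a' < 2" for a a'
    using assms that unfolding max_ent_def by auto
  have sq: "complex_of_real ((cmod z)\<^sup>2) = cnj z * z" for z
    by (simp only: complex_norm_square mult.commute)
  have "complex_of_real (\<Sum>b<2. (cmod (h b))\<^sup>2) = (\<Sum>b<2. \<Sum>a<2. \<Sum>a'<2. cnj (e a) * e a' * (\<phi> a b * cnj (\<phi> a' b)))"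
    unfolding of_real_sum sq h_def cnj_sum sum_product by (simp add: mult_ac)
  also have "\<dots> = (\<Sum>a<2. \<Sum>a'<2. cnj (e a) * e a' * (\<Sum>b<2. \<phi> a b * cnj (\<phi> a' b)))"
    unfolding sum_distrib_left by (rule sum_rotate)
  also have "\<dots> = (\<Sum>a<2. \<Sum>a'<2. cnj (e a) * e a' * (if a = a' then 1/2 else 0))"
    by (intro sum.cong refl) (simp add: m)
  also have "\<dots> = complex_of_real (1/2 * (\<Sum>a<2. (cmod (e a))\<^sup>2))"
    unfolding of_real_mult of_real_sum sq by (simp add: numeral_2_eq_2 algebra_simps)
  finally have h: "(\<Sum>b<2. (cmod (h b))\<^sup>2) = 1/2 * (\<Sum>a<2. (cmod (e a))\<^sup>2)"
    by (simp only: of_real_eq_iff)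
  have "(\<Sum>a<2. \<Sum>b<2. cnj (\<phi> a b) * (e a * f b)) = (\<Sum>b<2. h b * f b)"
    by (simp add: h_def numeral_2_eq_2 algebra_simps)
  also have "cmod \<dots> \<le> (\<Sum>b<2. cmod (h b) * cmod (f b))"
    by (rule order_trans[OF norm_sum]) (simp add: norm_mult)
  finally have "(cmod (\<Sum>a<2. \<Sum>b<2. cnj (\<phi> a b) * (e a * f b)))\<^sup>2 \<le> (\<Sum>b<2. cmod (h b) * cmod (f b))\<^sup>2"
    by (rule power_mono) simp
  also have "\<dots> \<le> (\<Sum>b<2. (cmod (h b))\<^sup>2) * (\<Sum>b<2. (cmod (f b))\<^sup>2)"
  proof -
    \<comment> \<open>Lagrange's identity: the two sides differ by
      \<open>(p * s - r * q)\<^sup>2\<close>.\<close>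
    have "(p * q + r * s)\<^sup>2 \<le> (p\<^sup>2 + r\<^sup>2) * (q\<^sup>2 + s\<^sup>2)" for p q r s :: real
      using zero_le_power2[of "p * s - r * q"] by (simp add: power2_eq_square algebra_simps)
    then show ?thesis by (simp add: numeral_2_eq_2)
  qed
  also have "\<dots> = 1/2 * (\<Sum>a<2. \<Sum>b<2. (cmod (e a * f b))\<^sup>2)"
    unfolding h by (simp add: sum_product norm_mult power_mult_distrib)
  finally show ?thesis .
qed

lemma fid_proj:
  "fid \<phi> (\<lambda>i i'. u i * cnj (u i')) = (cmod (\<Sum>a<2. \<Sum>b<2. cnj (\<phi> a b) * u (ix2 a b)))\<^sup>2"
proof -
  let ?s = "\<Sum>a<2. \<Sum>b<2. cnj (\<phi> a b) * u (ix2 a b)"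
  have "(\<Sum>a<2. \<Sum>b<2. \<Sum>a'<2. \<Sum>b'<2. cnj (\<phi> a b) * (u (ix2 a b) * cnj (u (ix2 a' b'))) * \<phi> a' b')
     = ?s * cnj ?s"
  proof -
    have "?s * cnj ?s = (\<Sum>a<2. \<Sum>b<2. (cnj (\<phi> a b) * u (ix2 a b)) * cnj ?s)"
      by (simp only: sum_distrib_right)
    then show ?thesis by (simp add: sum_distrib_left sum_distrib_right mult_ac)
  qed
  also have "\<dots> = complex_of_real ((cmod ?s)\<^sup>2)"
    by (simp only: complex_norm_square)
  finally show ?thesis unfolding fid_def by (simp only: Re_complex_of_real)
qed

lemma fid_add: "fid \<phi> (\<lambda>i i'. X i i' + Y i i') = fid \<phi> X + fid \<phi> Y"
  by (simp add: fid_def algebra_simps sum.distrib)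

lemma fid_diff: "fid \<phi> (\<lambda>i i'. X i i' - Y i i') = fid \<phi> X - fid \<phi> Y"
  by (simp add: fid_def algebra_simps sum_subtractf)

lemma fid_zero: "fid \<phi> (\<lambda>i i'. 0) = 0"
  by (simp add: fid_def)

lemma fid_sum: "fid \<phi> (\<lambda>i i'. \<Sum>c\<in>A. X c i i') = (\<Sum>c\<in>A. fid \<phi> (X c))"
  by (induction A rule: infinite_finite_induct) (simp_all add: fid_zero fid_add)

lemma fid_opsum: "fid \<phi> (opsum L) = (\<Sum>u\<leftarrow>L. (cmod (\<Sum>a<2. \<Sum>b<2. cnj (\<phi> a b) * u (ix2 a b)))\<^sup>2)"
  by (induction L) (simp_all add: opsum_Nil opsum_Cons fid_zero fid_add fid_proj)

text \<open>Serves twice: it makes the set behind \<open>FEF\<close> nonempty, and it supplies the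
  state against which the filtering protocol is tested.\<close>

lemma max_ent_standard:
  assumes "x < 2" "y < 2"
  shows "max_ent (\<lambda>a b. if a = x \<and> b = y \<or> a \<noteq> x \<and> b \<noteq> y then complex_of_real (1 / sqrt 2) else 0)"
proof -
  have "complex_of_real (1 / sqrt 2) * complex_of_real (1 / sqrt 2) = 1/2"
    by (simp only: of_real_mult[symmetric]) simp
  then show ?thesis
    using assms unfolding max_ent_def by (auto simp: numeral_2_eq_2 less_Suc_eq)
qed

lemma FEF_le:
  assumes "\<And>\<phi>. max_ent \<phi> \<Longrightarrow> fid \<phi> X \<le> c"
  shows "FEF X \<le> c"
  unfolding FEF_fid
  by (rule cSup_least) (use assms max_ent_standard[of 0 0] in auto)

text \<open>The supremum needs a bounded set: entries of a maximally entangled vector have modulus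
  at most 1, so for any \<open>X\<close>, positive or not, the sum of the moduli of its sixteen
  entries bounds every overlap.\<close>

lemma FEF_ge:
  assumes "max_ent \<phi>"
  shows "fid \<phi> X \<le> FEF X"
  unfolding FEF_fid
proof (rule cSup_upper)
  show "bdd_above {fid \<phi> X |\<phi>. max_ent \<phi>}"
  proof (rule bdd_aboveI, clarify)
    fix \<phi> assume m: "max_ent \<phi>"
    have le1: "cmod (\<phi> a b) \<le> 1" if "a < 2" "b < 2" for a b
    proof -
      have "(\<Sum>b<2. complex_of_real ((cmod (\<phi> a b))\<^sup>2)) = 1/2"
        using m that unfolding max_ent_def by (simp only: complex_norm_square) auto
      then have "complex_of_real (\<Sum>b<2. (cmod (\<phi> a b))\<^sup>2) = complex_of_real (1/2)"
        by simp
      then have "(\<Sum>b<2. (cmod (\<phi> a b))\<^sup>2) = 1/2"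
        by (simp only: of_real_eq_iff)
      moreover have "(cmod (\<phi> a b))\<^sup>2 \<le> (\<Sum>b<2. (cmod (\<phi> a b))\<^sup>2)"
        by (rule member_le_sum) (use that in auto)
      ultimately have "(cmod (\<phi> a b))\<^sup>2 \<le> 1\<^sup>2" by simp
      then show ?thesis using power2_le_imp_le zero_le_one by blast
    qed
    have "fid \<phi> X \<le> cmod (\<Sum>a<2. \<Sum>b<2. \<Sum>a'<2. \<Sum>b'<2. cnj (\<phi> a b) * X (ix2 a b) (ix2 a' b') * \<phi> a' b')"
      unfolding fid_def by (rule complex_Re_le_cmod)
    also have "\<dots> \<le> (\<Sum>a<2. \<Sum>b<2. \<Sum>a'<2. \<Sum>b'<2. cmod (X (ix2 a b) (ix2 a' b')))"
    proof (intro sum_norm_le)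
      fix a b a' b' :: nat assume "a \<in> {..<2}" "b \<in> {..<2}" "a' \<in> {..<2}" "b' \<in> {..<2}"
      then have "cmod (\<phi> a b) \<le> 1" "cmod (\<phi> a' b') \<le> 1" using le1 by auto
      then have "cmod (\<phi> a b) * cmod (X (ix2 a b) (ix2 a' b')) * cmod (\<phi> a' b') \<le> 1 * cmod (X (ix2 a b) (ix2 a' b')) * 1"
        by (intro mult_mono) auto
      then show "cmod (cnj (\<phi> a b) * X (ix2 a b) (ix2 a' b') * \<phi> a' b') \<le> cmod (X (ix2 a b) (ix2 a' b'))"
        by (simp add: norm_mult)
    qed
    finally show "fid \<phi> X \<le> (\<Sum>a<2. \<Sum>b<2. \<Sum>a'<2. \<Sum>b'<2. cmod (X (ix2 a b) (ix2 a' b')))" .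
  qed
qed (use assms in blast)

section \<open>Index sums and the bounds at the leaves\<close>

lemma mem_idx_two: "i \<in> idx [k, l] \<longleftrightarrow> i 0 < k \<and> i 1 < l \<and> ix2 (i 0) (i 1) = i"
proof -
  have "i \<in> idx [k, l] \<longleftrightarrow> i 0 < k \<and> i 1 < l \<and> (\<forall>j\<ge>2. i j = 0)"
    by (auto simp: idx_def less_Suc_eq numeral_2_eq_2)
  moreover have "j \<ge> 2 \<longleftrightarrow> j \<noteq> 0 \<and> j \<noteq> 1" for j :: nat
    by auto
  then have "(\<forall>j\<ge>2. i j = 0) \<longleftrightarrow> ix2 (i 0) (i 1) = i"
    by (auto simp: ix2_def fun_eq_iff)
  ultimately show ?thesis by simp
qed

lemma mem_idx_four:
  "i \<in> idx [k, m, n, l] \<longleftrightarrow>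
     i 0 < k \<and> i 1 < m \<and> i 2 < n \<and> i 3 < l \<and> ix4 (i 0) (i 1) (i 2) (i 3) = i"
proof -
  have "i \<in> idx [k, m, n, l] \<longleftrightarrow> i 0 < k \<and> i 1 < m \<and> i 2 < n \<and> i 3 < l \<and> (\<forall>j\<ge>4. i j = 0)"
    by (auto simp: idx_def less_Suc_eq eval_nat_numeral)
  moreover have "j \<ge> 4 \<longleftrightarrow> j \<noteq> 0 \<and> j \<noteq> 1 \<and> j \<noteq> 2 \<and> j \<noteq> 3" for j :: nat
    by auto
  then have "(\<forall>j\<ge>4. i j = 0) \<longleftrightarrow> ix4 (i 0) (i 1) (i 2) (i 3) = i"
    by (auto simp: ix4_def fun_eq_iff)
  ultimately show ?thesis by simp
qed

lemma sum_idx_two: "(\<Sum>i\<in>idx [k, l]. f i) = (\<Sum>a<k. \<Sum>b<l. f (ix2 a b))"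
proof -
  have "(\<Sum>i\<in>idx [k, l]. f i) = (\<Sum>(a, b)\<in>{..<k} \<times> {..<l}. f (ix2 a b))"
    by (rule sum.reindex_bij_witness[where i = "\<lambda>(a, b). ix2 a b" and j = "\<lambda>i. (i 0, i 1)"])
      (auto simp: mem_idx_two, auto simp: ix2_def)
  then show ?thesis by (simp add: sum.cartesian_product)
qed

lemma sum_idx_four:
  "(\<Sum>i\<in>idx [k, m, n, l]. f i) = (\<Sum>a<k. \<Sum>c<m. \<Sum>e<n. \<Sum>b<l. f (ix4 a c e b))"
proof -
  have "(\<Sum>i\<in>idx [k, m, n, l]. f i) =
      (\<Sum>(a, c, e, b)\<in>{..<k} \<times> {..<m} \<times> {..<n} \<times> {..<l}. f (ix4 a c e b))"
    by (rule sum.reindex_bij_witness[where i = "\<lambda>(a, c, e, b). ix4 a c e b" and j = "\<lambda>i. (i 0, i 1, i 2, i 3)"])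
      (auto simp: mem_idx_four, auto simp: ix4_def)
  then show ?thesis by (simp add: sum.cartesian_product)
qed

lemma bipartite_product_two:
  assumes "bipartite_product {0} u"
  obtains e f where "\<And>a b. u (ix2 a b) = e a * f b"
proof -
  from assms obtain E G where u: "u = (\<lambda>i. E i * G i)"
    and G: "\<And>i j a. j \<in> {0} \<Longrightarrow> G (i(j := a)) = G i"
    and E: "\<And>i j a. j \<notin> {0} \<Longrightarrow> E (i(j := a)) = E i"
    unfolding bipartite_product_def by blast
  have "ix2 a b = (ix2 0 b)(0 := a)" "ix2 a b = (ix2 a 0)(1 := b)" for a b
    by (auto simp: ix2_def fun_eq_iff)
  then have "u (ix2 a b) = E (ix2 a 0) * G (ix2 0 b)" for a b
    unfolding u by (metis E G insertI1 singletonD zero_neq_one)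
  then show ?thesis by (rule that)
qed

text \<open>Only the coordinates of A and B are separated; \<open>c\<close> and \<open>d\<close>
  stay fixed and the factors may vary with them. Each factor ignores the coordinate of the opposite
  end, which can be frozen at 0.\<close>

lemma bipartite_product_four:
  assumes "bipartite_product {0, 1} u"
  obtains e f where "\<And>a b. u (ix4 a c d b) = e a * f b"
proof -
  from assms obtain E G where u: "u = (\<lambda>i. E i * G i)"
    and G: "\<And>i j a. j \<in> {0, 1} \<Longrightarrow> G (i(j := a)) = G i"
    and E: "\<And>i j a. j \<notin> {0, 1} \<Longrightarrow> E (i(j := a)) = E i"
    unfolding bipartite_product_def by blast
  have "E (ix4 a c d b) = E (ix4 a c d 0)" "G (ix4 a c d b) = G (ix4 0 c d b)" for a b
  proof -
    have "ix4 a c d b = (ix4 0 c d b)(0 := a)" "ix4 a c d b = (ix4 a c d 0)(3 := b)"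
      by (auto simp: ix4_def fun_eq_iff)
    then show "E (ix4 a c d b) = E (ix4 a c d 0)" "G (ix4 a c d b) = G (ix4 0 c d b)"
      using E[of 3 "ix4 a c d 0" b] G[of 0 "ix4 0 c d b" a] by simp_all
  qed
  then have "u (ix4 a c d b) = E (ix4 a c d 0) * G (ix4 0 c d b)" for a b
    unfolding u by metis
  then show ?thesis by (rule that)
qed

text \<open>Overlaps of rank-one sums are sums of squares, so subtracting \<open>opsum M\<close> can
  only lower the value, and each vector of \<open>L\<close> falls under
  \<open>max_ent_overlap_product\<close>.\<close>

lemma FEF_leaf_two:
  assumes "\<forall>u\<in>set L. bipartite_product {0} u"
  shows "FEF (\<lambda>i i'. opsum L i i' - opsum M i i') \<le> 1/2 * (\<Sum>u\<leftarrow>L. sqn [2, 2] u)"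
proof (rule FEF_le)
  fix \<phi> assume m: "max_ent \<phi>"
  have "fid \<phi> (opsum L) \<le> (\<Sum>u\<leftarrow>L. 1/2 * sqn [2, 2] u)"
    unfolding fid_opsum
  proof (rule sum_list_mono)
    fix u assume "u \<in> set L"
    then obtain e f where "\<And>a b. u (ix2 a b) = e a * f b"
      using assms bipartite_product_two by meson
    then show "(cmod (\<Sum>a<2. \<Sum>b<2. cnj (\<phi> a b) * u (ix2 a b)))\<^sup>2 \<le> 1/2 * sqn [2, 2] u"
      using max_ent_overlap_product[OF m, of e f] by (simp add: sqn_def sum_idx_two)
  qed
  moreover have "fid \<phi> (opsum M) \<ge> 0"
    unfolding fid_opsum by (intro sum_list_nonneg) auto
  ultimately show "fid \<phi> (\<lambda>i i'. opsum L i i' - opsum M i i') \<le> 1/2 * (\<Sum>u\<leftarrow>L. sqn [2, 2] u)"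
    unfolding fid_diff sum_list_const_mult by linarith
qed

text \<open>The partial trace cuts each vector into slices, one per pair of basis states of the
  middle nodes. Every slice is a product vector of A and B, and the squared norms of the slices add
  up to the weight of the whole vector.\<close>

lemma FEF_leaf_four:
  assumes "rep_ok ds" "\<forall>u\<in>set L. bipartite_product {0, 1} u"
  shows "FEF (reduce_AB ds (\<lambda>i i'. opsum L i i' - opsum M i i')) \<le> 1/2 * (\<Sum>u\<leftarrow>L. sqn ds u)"
proof (rule FEF_le)
  fix \<phi> assume m: "max_ent \<phi>"
  obtain c d where ds: "ds = [2, c, d, 2]"
    using assms(1) unfolding rep_ok_def
    by (auto simp: length_Suc_conv eval_nat_numeral)
  let ?r = "\<lambda>k l u i. u (ix4 (i 0) k l (i 1))"
  have red: "fid \<phi> (reduce_AB ds (opsum N)) = (\<Sum>k<c. \<Sum>l<d. fid \<phi> (opsum (map (?r k l) N)))" for N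
    by (simp add: ds reduce_AB_def fid_sum opsum_def comp_def)
  have "fid \<phi> (reduce_AB ds (opsum L)) \<le> (\<Sum>k<c. \<Sum>l<d. \<Sum>u\<leftarrow>L. 1/2 * (\<Sum>a<2. \<Sum>b<2. (cmod (u (ix4 a k l b)))\<^sup>2))"
    unfolding red fid_opsum map_map
  proof (intro sum_mono sum_list_mono)
    fix k l u assume "u \<in> set L"
    then obtain e f where "\<And>a b. u (ix4 a k l b) = e a * f b"
      using assms bipartite_product_four by meson
    then show "((\<lambda>u. (cmod (\<Sum>a<2. \<Sum>b<2. cnj (\<phi> a b) * u (ix2 a b)))\<^sup>2) \<circ> ?r k l) u
        \<le> 1/2 * (\<Sum>a<2. \<Sum>b<2. (cmod (u (ix4 a k l b)))\<^sup>2)"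
      using max_ent_overlap_product[OF m, of e f] by (simp add: ix2_def)
  qed
  also have "\<dots> = (\<Sum>u\<leftarrow>L. 1/2 * (\<Sum>k<c. \<Sum>l<d. \<Sum>a<2. \<Sum>b<2. (cmod (u (ix4 a k l b)))\<^sup>2))"
    by (simp add: sum_list_sum_swap sum_distrib_left)
  also have "\<dots> = (\<Sum>u\<leftarrow>L. 1/2 * sqn ds u)"
  proof -
    have "(\<Sum>k<c. \<Sum>l<d. \<Sum>a<2. \<Sum>b<2. (cmod (u (ix4 a k l b)))\<^sup>2) = sqn ds u" for u
      unfolding sqn_def ds sum_idx_four by (simp add: numeral_2_eq_2 sum.distrib)
    then show ?thesis by simp
  qed
  finally have "fid \<phi> (reduce_AB ds (opsum L)) \<le> 1/2 * (\<Sum>u\<leftarrow>L. sqn ds u)"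
    by (simp only: sum_list_const_mult)
  moreover have "fid \<phi> (reduce_AB ds (opsum M)) \<ge> 0"
    unfolding red fid_opsum by (intro sum_nonneg sum_list_nonneg) auto
  moreover have "reduce_AB ds (\<lambda>i i'. opsum L i i' - opsum M i i') =
      (\<lambda>i i'. reduce_AB ds (opsum L) i i' - reduce_AB ds (opsum M) i i')"
    by (simp add: reduce_AB_def sum_subtractf)
  ultimately show "fid \<phi> (reduce_AB ds (\<lambda>i i'. opsum L i i' - opsum M i i')) \<le> 1/2 * (\<Sum>u\<leftarrow>L. sqn ds u)"
    by (simp add: fid_diff)
qed

section \<open>Separable completion and the upper bound\<close>

definition corr_vec :: "nat \<Rightarrow> nat \<Rightarrow> real \<Rightarrow> real \<Rightarrow> nat \<Rightarrow> nat \<Rightarrow> complex" where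
  "corr_vec x y \<alpha> \<beta> a b =
     (if a = x \<and> b = y then of_real \<alpha> else if a = 1 - x \<and> b = 1 - y then of_real \<beta> else 0)"

definition unit_vec :: "nat \<Rightarrow> nat \<Rightarrow> real \<Rightarrow> nat \<Rightarrow> nat \<Rightarrow> complex" where
  "unit_vec x y \<omega> a b = (if a = x \<and> b = y then of_real \<omega> else 0)"

text \<open>Used with \<open>r = \<beta> z / \<omega>\<close> and, in \<open>prod_right\<close>,
  \<open>s = \<omega> / z\<close>. Then the product has amplitudes \<open>\<alpha>\<close>,
  \<open>\<beta>\<close>, \<open>\<omega> / z\<close> and
  \<open>\<alpha> \<beta> z / \<omega>\<close>, all halved; the last one is forced, as the 2 x 2
  amplitude matrix has rank one. The halves give each of four such vectors weight one
  quarter.\<close>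

definition prod_left :: "nat \<Rightarrow> complex \<Rightarrow> nat \<Rightarrow> complex" where
  "prod_left x r a = (if a = x then 1/2 else if a = 1 - x then r/2 else 0)"

definition prod_right :: "nat \<Rightarrow> real \<Rightarrow> complex \<Rightarrow> nat \<Rightarrow> complex" where
  "prod_right y \<alpha> s b = (if b = y then of_real \<alpha> else if b = 1 - y then s else 0)"

text \<open>Basis labels \<open>x, y\<close> in \<open>{0, 1}\<close> play the role of \<open>|00\<rangle>\<close>, so that the bit flips
  caused by Bell outcomes 2 and 3 need no separate treatment.\<close>
definition x_state :: "nat \<Rightarrow> nat \<Rightarrow> real \<Rightarrow> real \<Rightarrow> real \<Rightarrow> gop" where
  "x_state x y \<alpha> \<beta> \<omega> =
     opsum [\<lambda>i. corr_vec x y \<alpha> \<beta> (i 0) (i 1), \<lambda>i. unit_vec x (1 - y) \<omega> (i 0) (i 1)]"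

text \<open>The cross terms carry \<open>z\<close>, its square or their conjugates, and all of these
  average to zero over the fourth roots; 1 and -1 alone would leave the squares.\<close>

definition phases :: "complex list" where
  "phases = [1, -1, \<i>, -\<i>]"

lemma sum_phases_quarter: "(\<Sum>z\<leftarrow>phases. 1/4 * c) = (c :: real)"
  by (simp add: phases_def)

lemma phases_cmod: "z \<in> set phases \<Longrightarrow> cmod z = 1"
  by (auto simp: phases_def)

lemma sum_phases:
  "(\<Sum>z\<leftarrow>phases. (A + cnj z * B + z * C) / 2 * cnj ((A' + cnj z * B' + z * C') / 2))
     = A * cnj A' + B * cnj B' + C * cnj C'"
  by (simp add: phases_def field_simps)

text \<open>Averaging over fourth roots of unity \<open>z\<close> removes every cross term of a product vector
  whose components carry the phases \<open>1, z, 1/z\<close>.\<close>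
lemma separable_completion:
  fixes \<alpha> \<beta> \<omega> :: real
  assumes "x < 2" "y < 2" "\<omega> \<noteq> 0"
  defines "v \<equiv> \<lambda>z a b. prod_left x (of_real (\<beta> / \<omega>) * z) a * prod_right y \<alpha> (of_real \<omega> * cnj z) b"
  shows "corr_vec x y \<alpha> \<beta> a b * cnj (corr_vec x y \<alpha> \<beta> a' b')
       + unit_vec x (1 - y) \<omega> a b * cnj (unit_vec x (1 - y) \<omega> a' b')
    = (\<Sum>z\<leftarrow>phases. v z a b * cnj (v z a' b'))
       - unit_vec (1 - x) y (\<alpha> * \<beta> / \<omega>) a b * cnj (unit_vec (1 - x) y (\<alpha> * \<beta> / \<omega>) a' b')"
proof -
  have v: "v z a b = (corr_vec x y \<alpha> \<beta> a b + cnj z * unit_vec x (1 - y) \<omega> a b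
      + z * unit_vec (1 - x) y (\<alpha> * \<beta> / \<omega>) a b) / 2" if "z \<in> set phases" for z a b
  proof -
    have "z * cnj z = 1"
      using that by (auto simp: phases_def)
    moreover have "Suc 0 - x \<noteq> x" "Suc 0 - y \<noteq> y"
      using assms(1,2) by presburger+
    ultimately show ?thesis
      using assms(3)
      by (auto simp: v_def corr_vec_def unit_vec_def prod_left_def prod_right_def field_simps)
  qed
  have "(\<Sum>z\<leftarrow>phases. v z a b * cnj (v z a' b')) = (\<Sum>z\<leftarrow>phases.
      (corr_vec x y \<alpha> \<beta> a b + cnj z * unit_vec x (1 - y) \<omega> a b
        + z * unit_vec (1 - x) y (\<alpha> * \<beta> / \<omega>) a b) / 2
      * cnj ((corr_vec x y \<alpha> \<beta> a' b' + cnj z * unit_vec x (1 - y) \<omega> a' b'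
        + z * unit_vec (1 - x) y (\<alpha> * \<beta> / \<omega>) a' b') / 2))"
    by (intro arg_cong[where f = sum_list] map_cong refl) (simp only: v)
  then show ?thesis
    unfolding sum_phases by simp
qed

lemma sum_prod_left:
  assumes "x < 2" "cmod r = c"
  shows "(\<Sum>a<2. (cmod (prod_left x r a))\<^sup>2) = (1 + c\<^sup>2) / 4"
  using assms by (auto simp: prod_left_def numeral_2_eq_2 less_Suc_eq norm_divide power_divide field_simps)

lemma sum_prod_right:
  assumes "y < 2" "cmod s = c"
  shows "(\<Sum>b<2. (cmod (prod_right y \<alpha> s b))\<^sup>2) = \<alpha>\<^sup>2 + c\<^sup>2"
  using assms by (auto simp: prod_right_def numeral_2_eq_2 less_Suc_eq)

text \<open>The phase drops out, and \<open>(\<alpha>\<^sup>2 + \<omega>\<^sup>2) (1 +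
  \<beta>\<^sup>2 / \<omega>\<^sup>2)\<close> expands to the trace of the state plus the weight of
  the completing vector.\<close>

lemma prod_sqn:
  assumes "x < 2" "y < 2" "\<omega> \<noteq> 0" "cmod z = 1"
  shows "(\<Sum>a<2. (cmod (prod_left x (of_real (\<beta> / \<omega>) * z) a))\<^sup>2)
        * (\<Sum>b<2. (cmod (prod_right y \<alpha> (of_real \<omega> * cnj z) b))\<^sup>2)
      = 1/4 * (\<alpha>\<^sup>2 + \<beta>\<^sup>2 + \<omega>\<^sup>2 + \<alpha>\<^sup>2 * \<beta>\<^sup>2 / \<omega>\<^sup>2)"
proof -
  have "cmod (of_real (\<beta> / \<omega>) * z) = \<bar>\<beta> / \<omega>\<bar>" "cmod (of_real \<omega> * cnj z) = \<bar>\<omega>\<bar>"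
    using assms(4) by (simp_all add: norm_mult norm_divide)
  note s = sum_prod_left[OF assms(1) this(1)] sum_prod_right[OF assms(2) this(2)]
  show ?thesis
    unfolding s using assms(3) by (simp add: power_divide field_simps)
qed

lemma pval_x_state_le:
  assumes "valid (\<lambda>ds. ds = [2, 2]) P [2, 2]" "x < 2" "y < 2" "\<omega> \<noteq> 0"
  shows "pval (\<lambda>ds Y. FEF Y) P [2, 2] (x_state x y \<alpha> \<beta> \<omega>)
    \<le> 1/2 * (\<alpha>\<^sup>2 + \<beta>\<^sup>2 + \<omega>\<^sup>2 + \<alpha>\<^sup>2 * \<beta>\<^sup>2 / \<omega>\<^sup>2)"
proof -
  define u where "u z = (\<lambda>i::nat \<Rightarrow> nat. prod_left x (of_real (\<beta> / \<omega>) * z) (i 0) * prod_right y \<alpha> (of_real \<omega> * cnj z) (i 1))" for z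
  define L where "L = map u phases"
  define M where "M = [\<lambda>i::nat \<Rightarrow> nat. unit_vec (1 - x) y (\<alpha> * \<beta> / \<omega>) (i 0) (i 1)]"
  have X: "x_state x y \<alpha> \<beta> \<omega> = (\<lambda>i i'. opsum L i i' - opsum M i i')"
    using separable_completion[OF assms(2-4)]
    by (simp add: x_state_def opsum_def L_def M_def comp_def u_def fun_eq_iff)
  have bp: "\<forall>u\<in>set L. bipartite_product {0} u"
  proof -
    have "bipartite_product {0} (\<lambda>i. e (i 0) * f (i 1))" for e f :: "nat \<Rightarrow> complex"
      unfolding bipartite_product_def
      by (rule exI[where x = "\<lambda>i. e (i 0)"], rule exI[where x = "\<lambda>i. f (i 1)"]) auto
    then show ?thesis by (auto simp: L_def u_def)
  qed
  have sq: "sqn [2, 2] (u z) = 1/4 * (\<alpha>\<^sup>2 + \<beta>\<^sup>2 + \<omega>\<^sup>2 + \<alpha>\<^sup>2 * \<beta>\<^sup>2 / \<omega>\<^sup>2)" if "z \<in> set phases" for z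
  proof -
    have "sqn [2, 2] (u z) = (\<Sum>a<2. (cmod (prod_left x (of_real (\<beta> / \<omega>) * z) a))\<^sup>2)
        * (\<Sum>b<2. (cmod (prod_right y \<alpha> (of_real \<omega> * cnj z) b))\<^sup>2)"
      by (simp add: sqn_def sum_idx_two u_def ix2_def sum_product norm_mult power_mult_distrib)
    also have "\<dots> = 1/4 * (\<alpha>\<^sup>2 + \<beta>\<^sup>2 + \<omega>\<^sup>2 + \<alpha>\<^sup>2 * \<beta>\<^sup>2 / \<omega>\<^sup>2)"
      by (rule prod_sqn[OF assms(2-4) phases_cmod[OF that]])
    finally show ?thesis .
  qed
  have "(\<Sum>u\<leftarrow>L. sqn [2, 2] u) = (\<Sum>z\<leftarrow>phases. 1/4 * (\<alpha>\<^sup>2 + \<beta>\<^sup>2 + \<omega>\<^sup>2 + \<alpha>\<^sup>2 * \<beta>\<^sup>2 / \<omega>\<^sup>2))"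
    unfolding L_def map_map by (intro arg_cong[where f = sum_list] map_cong refl) (simp add: sq)
  also have "\<dots> = \<alpha>\<^sup>2 + \<beta>\<^sup>2 + \<omega>\<^sup>2 + \<alpha>\<^sup>2 * \<beta>\<^sup>2 / \<omega>\<^sup>2"
    by (rule sum_phases_quarter)
  finally have tr: "(\<Sum>u\<leftarrow>L. sqn [2, 2] u) = \<alpha>\<^sup>2 + \<beta>\<^sup>2 + \<omega>\<^sup>2 + \<alpha>\<^sup>2 * \<beta>\<^sup>2 / \<omega>\<^sup>2" .
  show ?thesis
    unfolding X tr[symmetric]
    by (rule pval_le_half_sqn[OF _ assms(1) bp]) (simp only: FEF_leaf_two)
qed

section \<open>The segment state and the repeater state as rank-one sums\<close>

lemma sum_lessThan_4: "(\<Sum>c<4. f c) = f 0 + f 1 + f 2 + f (3::nat)"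
  by (simp add: eval_nat_numeral algebra_simps)

lemma psi_st_weights:
  assumes "0 \<le> q" "q \<le> 1"
  shows "(\<Sum>a<2. (cmod (psi_st q a 0))\<^sup>2) = q" "(\<Sum>a<2. (cmod (psi_st q a 1))\<^sup>2) = 1 - q"
    "(\<Sum>b<2. (cmod (psi_st q 0 b))\<^sup>2) = q" "(\<Sum>b<2. (cmod (psi_st q 1 b))\<^sup>2) = 1 - q"
  using assms by (simp_all add: psi_st_def numeral_2_eq_2)

lemma rho_pd_eq:
  assumes "0 \<le> p" "p \<le> 1"
  shows "rho_pd p \<delta> a b a' b' =
      corr_vec 0 0 (sqrt (1 - p) * sqrt \<delta>) (sqrt (1 - p) * sqrt (1 - \<delta>)) a b
        * cnj (corr_vec 0 0 (sqrt (1 - p) * sqrt \<delta>) (sqrt (1 - p) * sqrt (1 - \<delta>)) a' b')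
      + unit_vec 0 (1 - 0) (sqrt p) a b * cnj (unit_vec 0 (1 - 0) (sqrt p) a' b')"
proof -
  have sq: "complex_of_real (sqrt q) * of_real (sqrt q) = of_real q" if "0 \<le> q" for q
    using that by (simp only: of_real_mult[symmetric]) simp
  have c: "corr_vec 0 0 (sqrt (1 - p) * sqrt \<delta>) (sqrt (1 - p) * sqrt (1 - \<delta>)) a b
     = of_real (sqrt (1 - p)) * psi_st \<delta> a b" for a b
    by (simp add: corr_vec_def psi_st_def)
  have "of_real (sqrt (1 - p)) * psi_st \<delta> a b * cnj (of_real (sqrt (1 - p)) * psi_st \<delta> a' b')
     = (of_real (sqrt (1 - p)) * of_real (sqrt (1 - p))) * psi_st \<delta> a b * cnj (psi_st \<delta> a' b')"
    by (simp add: mult_ac)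
  moreover have "unit_vec 0 (1 - 0) (sqrt p) a b * cnj (unit_vec 0 (1 - 0) (sqrt p) a' b')
      = (if a = 0 \<and> b = 1 \<and> a' = 0 \<and> b' = 1 then complex_of_real p else 0)"
    using assms sq[of p] by (simp add: unit_vec_def)
  moreover have "of_real (sqrt (1 - p)) * of_real (sqrt (1 - p)) = complex_of_real (1 - p)"
    using assms by (intro sq) simp
  ultimately show ?thesis
    unfolding c by (simp only: rho_pd_def add.commute)
qed

lemma rho_op_x_state:
  assumes "0 \<le> p" "p \<le> 1"
  shows "rho_op p \<delta> = x_state 0 0 (sqrt (1 - p) * sqrt \<delta>) (sqrt (1 - p) * sqrt (1 - \<delta>)) (sqrt p)"
  unfolding rho_op_def rho_pd_eq[OF assms] by (simp add: x_state_def opsum_def)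

text \<open>The ancillas are attached to an arbitrary vector \<open>h\<close> of the middle segment,
  so that identities for that segment lift to the repeater and a product \<open>h\<close> gives a
  product across the cut.\<close>

definition link_vec :: "real \<Rightarrow> real \<Rightarrow> (nat \<Rightarrow> nat \<Rightarrow> complex) \<Rightarrow> (nat \<Rightarrow> nat) \<Rightarrow> complex" where
  "link_vec al ar h = (\<lambda>i. psi_st al (i 0) (i 1 div 2) * h (i 1 mod 2) (i 2 div 2) * psi_st ar (i 2 mod 2) (i 3))"

lemma rep_init_link_vec:
  assumes "0 \<le> p" "p \<le> 1"
  shows "rep_init al p \<delta> ar =
     opsum [link_vec al ar (corr_vec 0 0 (sqrt (1 - p) * sqrt \<delta>) (sqrt (1 - p) * sqrt (1 - \<delta>))),
            link_vec al ar (unit_vec 0 (1 - 0) (sqrt p))]"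
  unfolding rep_init_def rho_pd_eq[OF assms]
  by (simp add: opsum_def link_vec_def fun_eq_iff algebra_simps)

lemma sqn_link_vec:
  assumes "0 \<le> al" "al \<le> 1" "0 \<le> ar" "ar \<le> 1"
  shows "sqn [2, 4, 4, 2] (link_vec al ar (\<lambda>a b. e a * f b)) =
     (\<Sum>a<2. (cmod (e a))\<^sup>2) * (\<Sum>b<2. (cmod (f b))\<^sup>2)"
proof -
  have "sqn [2, 4, 4, 2] (link_vec al ar (\<lambda>a b. e a * f b)) =
     (\<Sum>a<2. \<Sum>c<4. \<Sum>d<4. \<Sum>b<2. (cmod (psi_st al a (c div 2)))\<^sup>2 * (cmod (e (c mod 2)))\<^sup>2
        * ((cmod (f (d div 2)))\<^sup>2 * (cmod (psi_st ar (d mod 2) b))\<^sup>2))"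
    by (simp add: sqn_def sum_idx_four link_vec_def ix4_def norm_mult power_mult_distrib mult_ac)
  also have "\<dots> = (\<Sum>a<2. \<Sum>c<4. (cmod (psi_st al a (c div 2)))\<^sup>2 * (cmod (e (c mod 2)))\<^sup>2)
        * (\<Sum>d<4. \<Sum>b<2. (cmod (f (d div 2)))\<^sup>2 * (cmod (psi_st ar (d mod 2) b))\<^sup>2)"
    by (simp only: sum_distrib_right) (simp only: sum_distrib_left)
  also have "(\<Sum>a<2. \<Sum>c<4. (cmod (psi_st al a (c div 2)))\<^sup>2 * (cmod (e (c mod 2)))\<^sup>2)
     = (\<Sum>c<4. (\<Sum>a<2. (cmod (psi_st al a (c div 2)))\<^sup>2) * (cmod (e (c mod 2)))\<^sup>2)"
    by (subst sum.swap) (simp add: sum_distrib_right)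
  also have "\<dots> = (\<Sum>a<2. (cmod (e a))\<^sup>2)"
    using assms by (simp add: sum_lessThan_4 psi_st_weights psi_st_weights[unfolded One_nat_def])
      (simp add: numeral_2_eq_2 algebra_simps)
  also have "(\<Sum>d<4. \<Sum>b<2. (cmod (f (d div 2)))\<^sup>2 * (cmod (psi_st ar (d mod 2) b))\<^sup>2)
     = (\<Sum>d<4. (cmod (f (d div 2)))\<^sup>2 * (\<Sum>b<2. (cmod (psi_st ar (d mod 2) b))\<^sup>2))"
    by (simp add: sum_distrib_left)
  also have "\<dots> = (\<Sum>b<2. (cmod (f b))\<^sup>2)"
    using assms by (simp add: sum_lessThan_4 psi_st_weights psi_st_weights[unfolded One_nat_def])
      (simp add: numeral_2_eq_2 algebra_simps)
  finally show ?thesis .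
qed

text \<open>The cut crosses only the middle segment, and the normalised ancillas leave the weights
  of its product vectors unchanged; hence the bound is free of \<open>al\<close> and
  \<open>ar\<close>.\<close>

lemma pval_rep_init_le:
  assumes "valid rep_ok P [2, 4, 4, 2]" "0 < p" "p < 1" "0 \<le> \<delta>" "\<delta> \<le> 1"
    "0 \<le> al" "al \<le> 1" "0 \<le> ar" "ar \<le> 1"
  shows "pval (\<lambda>ds Y. FEF (reduce_AB ds Y)) P [2, 4, 4, 2] (rep_init al p \<delta> ar)
    \<le> 1/2 * (1 + (1 - p)\<^sup>2 * \<delta> * (1 - \<delta>) / p)"
proof -
  define \<alpha> \<beta> \<omega> where "\<alpha> = sqrt (1 - p) * sqrt \<delta>" and "\<beta> = sqrt (1 - p) * sqrt (1 - \<delta>)" and "\<omega> = sqrt p"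
  have two: "(0::nat) < 2" by simp
  have \<omega>: "\<omega> \<noteq> 0" using assms by (simp add: \<omega>_def)
  define h where "h z = (\<lambda>a b. prod_left 0 (of_real (\<beta> / \<omega>) * z) a * prod_right 0 \<alpha> (of_real \<omega> * cnj z) b)" for z
  define L where "L = map (\<lambda>z. link_vec al ar (h z)) phases"
  define M where "M = [link_vec al ar (unit_vec (1 - 0) 0 (\<alpha> * \<beta> / \<omega>))]"
  have X: "rep_init al p \<delta> ar = (\<lambda>i i'. opsum L i i' - opsum M i i')"
  proof (intro ext)
    fix i i' :: "nat \<Rightarrow> nat"
    \<comment> \<open>The ancilla amplitudes are a common factor of every term, which reduces the
      identity to the middle segment.\<close>
    let ?g = "psi_st al (i 0) (i 1 div 2) * psi_st ar (i 2 mod 2) (i 3)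
      * cnj (psi_st al (i' 0) (i' 1 div 2) * psi_st ar (i' 2 mod 2) (i' 3))"
    have g: "link_vec al ar k i * cnj (link_vec al ar k i') =
        ?g * (k (i 1 mod 2) (i 2 div 2) * cnj (k (i' 1 mod 2) (i' 2 div 2)))" for k
      by (simp add: link_vec_def mult_ac)
    have "rep_init al p \<delta> ar i i' = ?g * (corr_vec 0 0 \<alpha> \<beta> (i 1 mod 2) (i 2 div 2) * cnj (corr_vec 0 0 \<alpha> \<beta> (i' 1 mod 2) (i' 2 div 2))
       + unit_vec 0 (1 - 0) \<omega> (i 1 mod 2) (i 2 div 2) * cnj (unit_vec 0 (1 - 0) \<omega> (i' 1 mod 2) (i' 2 div 2)))"
      using assms by (simp only: rep_init_link_vec less_imp_le opsum_def list.map sum_list.Cons sum_list.Nil g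
          \<alpha>_def \<beta>_def \<omega>_def add_0_right distrib_left)
    also have "\<dots> = opsum L i i' - opsum M i i'"
      using separable_completion[OF two two \<omega>, where \<alpha> = \<alpha> and \<beta> = \<beta>]
      by (simp only: opsum_def L_def M_def map_map comp_def list.map sum_list.Cons sum_list.Nil g
          h_def add_0_right right_diff_distrib sum_list_const_mult)
    finally show "rep_init al p \<delta> ar i i' = opsum L i i' - opsum M i i'" .
  qed
  have bp: "\<forall>u\<in>set L. bipartite_product {0, 1} u"
  proof -
    have "bipartite_product {0, 1} (link_vec al ar (\<lambda>a b. e a * f b))" for e f
      unfolding bipartite_product_def link_vec_def
      by (rule exI[where x = "\<lambda>i. psi_st al (i 0) (i 1 div 2) * e (i 1 mod 2)"],
          rule exI[where x = "\<lambda>i. f (i 2 div 2) * psi_st ar (i 2 mod 2) (i 3)"])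
        (auto simp: mult_ac)
    then show ?thesis by (auto simp: L_def h_def)
  qed
  have val: "\<alpha>\<^sup>2 + \<beta>\<^sup>2 + \<omega>\<^sup>2 + \<alpha>\<^sup>2 * \<beta>\<^sup>2 / \<omega>\<^sup>2 = 1 + (1 - p)\<^sup>2 * \<delta> * (1 - \<delta>) / p"
    using assms by (simp add: \<alpha>_def \<beta>_def \<omega>_def power_mult_distrib) (simp add: field_simps power2_eq_square)
  have sq: "sqn [2, 4, 4, 2] (link_vec al ar (h z)) = 1/4 * (\<alpha>\<^sup>2 + \<beta>\<^sup>2 + \<omega>\<^sup>2 + \<alpha>\<^sup>2 * \<beta>\<^sup>2 / \<omega>\<^sup>2)"
    if "z \<in> set phases" for z
  proof -
    show ?thesis
      unfolding h_def sqn_link_vec[OF assms(6-9)] by (rule prod_sqn[OF two two \<omega> phases_cmod[OF that]])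
  qed
  have "(\<Sum>u\<leftarrow>L. sqn [2, 4, 4, 2] u) = (\<Sum>z\<leftarrow>phases. 1/4 * (\<alpha>\<^sup>2 + \<beta>\<^sup>2 + \<omega>\<^sup>2 + \<alpha>\<^sup>2 * \<beta>\<^sup>2 / \<omega>\<^sup>2))"
    unfolding L_def map_map by (intro arg_cong[where f = sum_list] map_cong refl) (simp add: sq)
  also have "\<dots> = 1 + (1 - p)\<^sup>2 * \<delta> * (1 - \<delta>) / p"
    unfolding val by (rule sum_phases_quarter)
  finally have tr: "(\<Sum>u\<leftarrow>L. sqn [2, 4, 4, 2] u) = 1 + (1 - p)\<^sup>2 * \<delta> * (1 - \<delta>) / p" .
  show ?thesis
    unfolding X tr[symmetric]
    by (rule pval_le_half_sqn[OF _ assms(1) bp]) (rule FEF_leaf_four)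
qed

section \<open>The filtering protocol\<close>

text \<open>Together with \<open>project\<close> at strength \<open>sqrt (1 - t\<^sup>2)\<close>
  this is a complete instrument. \<open>t\<close> may be negative, since some Bell outcomes reverse
  the sign of one amplitude.\<close>

definition attenuate :: "nat \<Rightarrow> real \<Rightarrow> nat \<Rightarrow> nat \<Rightarrow> complex" where
  "attenuate x t b a = (if b = a then if a = x then of_real t else 1 else 0)"

definition project :: "nat \<Rightarrow> real \<Rightarrow> nat \<Rightarrow> nat \<Rightarrow> complex" where
  "project x s b a = (if b = x \<and> a = x then of_real s else 0)"

definition reset :: "nat \<Rightarrow> nat \<Rightarrow> nat \<Rightarrow> nat \<Rightarrow> complex" where
  "reset y z b a = (if b = y \<and> a = z then 1 else 0)"

text \<open>\<open>j\<close> is the position of B: 1 with two parties, 3 in the repeater. Both reset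
  operators belong to one outcome, so B's old qubit is discarded without being read.\<close>

definition filter_protocol :: "nat \<Rightarrow> nat \<Rightarrow> real \<Rightarrow> nat \<Rightarrow> protocol" where
  "filter_protocol x y t j = Step 0 [(2, [attenuate x t], Stop),
     (2, [project x (sqrt (1 - t\<^sup>2))], Step j [(2, [reset y 0, reset y 1], Stop)])]"

lemma valid_filter_protocol:
  assumes "x < 2" "y < 2" "\<bar>t\<bar> \<le> 1" "j < length ds" "ds ! 0 = 2" "ds ! j = 2" "ok ds"
  shows "valid ok (filter_protocol x y t j) ds"
proof -
  have [simp]: "ds[0 := 2] = ds" "ds[j := 2] = ds"
    using assms(5,6) by (metis list_update_id)+
  have "t\<^sup>2 \<le> 1" using assms(3) by (simp add: abs_square_le_1)
  then have s: "complex_of_real (sqrt (1 - t\<^sup>2)) * of_real (sqrt (1 - t\<^sup>2)) = of_real (1 - t\<^sup>2)"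
    by (simp only: of_real_mult[symmetric]) simp
  have "trace_pres 2 [(2, [attenuate x t], Stop),
     (2, [project x (sqrt (1 - t\<^sup>2))], Step j [(2, [reset y 0, reset y 1], Stop)])]"
    using assms(1) s by (auto simp: trace_pres_def attenuate_def project_def numeral_2_eq_2 less_Suc_eq power2_eq_square)
  moreover have "trace_pres 2 [(2, [reset y 0, reset y 1], Stop)]"
    using assms(2) by (auto simp: trace_pres_def reset_def numeral_2_eq_2 less_Suc_eq)
  moreover have "0 < length ds" using assms(4) by linarith
  ultimately show ?thesis
    using assms by (simp add: filter_protocol_def)
qed

lemma kvec_two:
  "kvec [2, 2] 0 K (\<lambda>i. h (i 0) (i 1)) = (\<lambda>i. \<Sum>a<2. K (i 0) a * h a (i 1))"
  "kvec [2, 2] 1 K (\<lambda>i. h (i 0) (i 1)) = (\<lambda>i. \<Sum>b<2. K (i 1) b * h (i 0) b)"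
  by (simp_all add: kvec_def)

lemma kvec_attenuate:
  assumes "x < 2" "y < 2"
  shows "kvec [2, 2] 0 (attenuate x t) (\<lambda>i. corr_vec x y \<alpha> \<beta> (i 0) (i 1)) =
      (\<lambda>i. corr_vec x y (t * \<alpha>) \<beta> (i 0) (i 1))"
    "kvec [2, 2] 0 (attenuate x t) (\<lambda>i. unit_vec x (1 - y) \<omega> (i 0) (i 1)) =
      (\<lambda>i. unit_vec x (1 - y) (t * \<omega>) (i 0) (i 1))"
  unfolding kvec_two using assms
  by (auto simp: attenuate_def corr_vec_def unit_vec_def fun_eq_iff numeral_2_eq_2 less_Suc_eq)

lemma kvec_project:
  assumes "x < 2" "y < 2"
  shows "kvec [2, 2] 0 (project x s) (\<lambda>i. corr_vec x y \<alpha> \<beta> (i 0) (i 1)) =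
      (\<lambda>i. unit_vec x y (s * \<alpha>) (i 0) (i 1))"
    "kvec [2, 2] 0 (project x s) (\<lambda>i. unit_vec x (1 - y) \<omega> (i 0) (i 1)) =
      (\<lambda>i. unit_vec x (1 - y) (s * \<omega>) (i 0) (i 1))"
  unfolding kvec_two using assms
  by (auto simp: project_def corr_vec_def unit_vec_def fun_eq_iff numeral_2_eq_2 less_Suc_eq)

lemma kvec_reset:
  assumes "z < 2"
  shows "kvec [2, 2] 1 (reset y z) (\<lambda>i. unit_vec x y' \<omega> (i 0) (i 1)) =
      (\<lambda>i. unit_vec x y (if y' = z then \<omega> else 0) (i 0) (i 1))"
  unfolding kvec_two using assms
  by (auto simp: reset_def unit_vec_def fun_eq_iff numeral_2_eq_2 less_Suc_eq)

definition std_ent :: "nat \<Rightarrow> nat \<Rightarrow> nat \<Rightarrow> nat \<Rightarrow> complex" where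
  "std_ent x y a b = (if a = x \<and> b = y \<or> a \<noteq> x \<and> b \<noteq> y then complex_of_real (1 / sqrt 2) else 0)"

lemma max_ent_std_ent: "x < 2 \<Longrightarrow> y < 2 \<Longrightarrow> max_ent (std_ent x y)"
  unfolding std_ent_def by (rule max_ent_standard)

lemma overlap_corr_vec:
  assumes "x < 2" "y < 2"
  shows "(cmod (\<Sum>a<2. \<Sum>b<2. cnj (std_ent x y a b) * corr_vec x y \<alpha> \<beta> (ix2 a b 0) (ix2 a b 1)))\<^sup>2 = (\<alpha> + \<beta>)\<^sup>2 / 2"
proof -
  have "(\<Sum>a<2. \<Sum>b<2. cnj (std_ent x y a b) * corr_vec x y \<alpha> \<beta> (ix2 a b 0) (ix2 a b 1))
     = complex_of_real ((\<alpha> + \<beta>) / sqrt 2)"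
    using assms by (auto simp: std_ent_def corr_vec_def ix2_def numeral_2_eq_2 less_Suc_eq add_divide_distrib)
  then show ?thesis
    by (simp only: norm_of_real) (simp add: power_divide)
qed

lemma overlap_unit_vec:
  assumes "x < 2" "y < 2"
  shows "(cmod (\<Sum>a<2. \<Sum>b<2. cnj (std_ent x y a b) * unit_vec x y \<omega> (ix2 a b 0) (ix2 a b 1)))\<^sup>2 = \<omega>\<^sup>2 / 2"
proof -
  have "(\<Sum>a<2. \<Sum>b<2. cnj (std_ent x y a b) * unit_vec x y \<omega> (ix2 a b 0) (ix2 a b 1))
     = complex_of_real (\<omega> / sqrt 2)"
    using assms by (auto simp: std_ent_def unit_vec_def ix2_def numeral_2_eq_2 less_Suc_eq)
  then show ?thesis
    by (simp only: norm_of_real) (simp add: power_divide)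
qed

text \<open>Success contributes \<open>(t \<alpha> + \<beta>)\<^sup>2 / 2\<close>. Failure leaves a
  product state of weight \<open>(1 - t\<^sup>2) (\<alpha>\<^sup>2 + \<omega>\<^sup>2)\<close>, half
  of which counts. The sum is a concave quadratic in \<open>t\<close>, with its vertex at
  \<open>\<alpha> \<beta> / \<omega>\<^sup>2\<close>.\<close>

lemma pval_filter_protocol_ge:
  assumes "x < 2" "y < 2" "\<bar>t\<bar> \<le> 1"
  shows "pval (\<lambda>ds Y. FEF Y) (filter_protocol x y t 1) [2, 2] (x_state x y \<alpha> \<beta> \<omega>)
    \<ge> 1/2 * (\<alpha>\<^sup>2 + \<beta>\<^sup>2 + \<omega>\<^sup>2 + 2 * t * \<alpha> * \<beta> - t\<^sup>2 * \<omega>\<^sup>2)"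
proof -
  define s where "s = sqrt (1 - t\<^sup>2)"
  have "t\<^sup>2 \<le> 1" using assms(3) by (simp add: abs_square_le_1)
  then have s2: "s\<^sup>2 = 1 - t\<^sup>2" by (simp add: s_def)
  let ?Y1 = "opsum [\<lambda>i. corr_vec x y (t * \<alpha>) \<beta> (i 0) (i 1), \<lambda>i. unit_vec x (1 - y) (t * \<omega>) (i 0) (i 1)]"
  let ?R = "\<lambda>z. opsum [\<lambda>i. unit_vec x y (if y = z then s * \<alpha> else 0) (i 0) (i 1),
      \<lambda>i. unit_vec x y (if 1 - y = z then s * \<omega> else 0) (i 0) (i 1)]"
  have "pval (\<lambda>ds Y. FEF Y) (filter_protocol x y t 1) [2, 2] (x_state x y \<alpha> \<beta> \<omega>)
      = FEF ?Y1 + FEF (\<lambda>i i'. ?R 0 i i' + ?R 1 i i')"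
    by (simp add: filter_protocol_def x_state_def apply_local_opsum s_def[symmetric]
        kvec_attenuate[OF assms(1,2), simplified] kvec_project[OF assms(1,2), simplified] kvec_reset[simplified])
  moreover have "fid (std_ent x y) ?Y1 \<le> FEF ?Y1"
    "fid (std_ent x y) (\<lambda>i i'. ?R 0 i i' + ?R 1 i i') \<le> FEF (\<lambda>i i'. ?R 0 i i' + ?R 1 i i')"
    by (intro FEF_ge max_ent_std_ent assms(1,2))+
  moreover have "fid (std_ent x y) ?Y1 \<ge> (t * \<alpha> + \<beta>)\<^sup>2 / 2"
    unfolding fid_opsum by (simp add: overlap_corr_vec[OF assms(1,2), simplified])
  moreover have "fid (std_ent x y) (\<lambda>i i'. ?R 0 i i' + ?R 1 i i') = ((s * \<alpha>)\<^sup>2 + (s * \<omega>)\<^sup>2) / 2"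
  proof -
    have "y = 0 \<or> y = 1" using assms(2) by auto
    then show ?thesis
      unfolding fid_add fid_opsum
      by (auto simp: overlap_unit_vec[OF assms(1,2), simplified])
  qed
  moreover have "1/2 * (\<alpha>\<^sup>2 + \<beta>\<^sup>2 + \<omega>\<^sup>2 + 2 * t * \<alpha> * \<beta> - t\<^sup>2 * \<omega>\<^sup>2)
      = (t * \<alpha> + \<beta>)\<^sup>2 / 2 + ((s * \<alpha>)\<^sup>2 + (s * \<omega>)\<^sup>2) / 2"
    by (simp add: power_mult_distrib s2) (simp add: power2_eq_square field_simps)
  ultimately show ?thesis
    by linarith
qed

text \<open>At the vertex the gain of the filter equals the weight of the completing vector in the
  upper bound, which is why the two bounds meet.\<close>

lemma filter_strength:
  fixes \<alpha> \<beta> \<omega> :: real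
  assumes "\<omega> \<noteq> 0" "\<alpha>\<^sup>2 * \<beta>\<^sup>2 \<le> \<omega> ^ 4"
  defines "t \<equiv> \<alpha> * \<beta> / \<omega>\<^sup>2"
  shows "\<bar>t\<bar> \<le> 1" "2 * t * \<alpha> * \<beta> - t\<^sup>2 * \<omega>\<^sup>2 = \<alpha>\<^sup>2 * \<beta>\<^sup>2 / \<omega>\<^sup>2"
proof -
  have "(\<alpha> * \<beta>)\<^sup>2 \<le> (\<omega>\<^sup>2)\<^sup>2"
    using assms(2) by (simp add: power_mult_distrib power2_eq_square[of "\<omega>\<^sup>2"] flip: power_add)
  then have "\<bar>\<alpha> * \<beta>\<bar> \<le> \<omega>\<^sup>2"
    using abs_le_square_iff[of "\<alpha> * \<beta>" "\<omega>\<^sup>2"] by simp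
  then show "\<bar>t\<bar> \<le> 1"
    using assms(1) by (simp add: t_def)
  show "2 * t * \<alpha> * \<beta> - t\<^sup>2 * \<omega>\<^sup>2 = \<alpha>\<^sup>2 * \<beta>\<^sup>2 / \<omega>\<^sup>2"
    using assms(1) by (simp add: t_def field_simps power2_eq_square)
qed

text \<open>For \<open>rho_op p \<delta>\<close> the product \<open>\<alpha> \<beta>\<close> is half
  of the quantity C in the known formula, so the hypothesis reads C at most 2p and the value is the
  second branch of that formula.\<close>

lemma Fstar_x_state:
  assumes "x < 2" "y < 2" "\<omega> \<noteq> 0" "\<alpha>\<^sup>2 * \<beta>\<^sup>2 \<le> \<omega> ^ 4"
  shows "Fstar (x_state x y \<alpha> \<beta> \<omega>) = 1/2 * (\<alpha>\<^sup>2 + \<beta>\<^sup>2 + \<omega>\<^sup>2 + \<alpha>\<^sup>2 * \<beta>\<^sup>2 / \<omega>\<^sup>2)"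
proof -
  let ?V = "{pval (\<lambda>ds Y. FEF Y) P [2, 2] (x_state x y \<alpha> \<beta> \<omega>) | P. valid (\<lambda>ds. ds = [2, 2]) P [2, 2]}"
  let ?v = "1/2 * (\<alpha>\<^sup>2 + \<beta>\<^sup>2 + \<omega>\<^sup>2 + \<alpha>\<^sup>2 * \<beta>\<^sup>2 / \<omega>\<^sup>2)"
  let ?P = "filter_protocol x y (\<alpha> * \<beta> / \<omega>\<^sup>2) 1"
  note t = filter_strength[OF assms(3,4)]
  have le: "v \<le> ?v" if "v \<in> ?V" for v
    using that pval_x_state_le[OF _ assms(1-3)] by auto
  have "valid (\<lambda>ds. ds = [2, 2]) ?P [2, 2]"
    by (rule valid_filter_protocol) (use assms(1,2) t(1) in simp_all)
  then have mem: "pval (\<lambda>ds Y. FEF Y) ?P [2, 2] (x_state x y \<alpha> \<beta> \<omega>) \<in> ?V"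
    by blast
  have "?v \<le> pval (\<lambda>ds Y. FEF Y) ?P [2, 2] (x_state x y \<alpha> \<beta> \<omega>)"
    using pval_filter_protocol_ge[OF assms(1,2) t(1), of \<alpha> \<beta> \<omega>] t(2) by argo
  then have "pval (\<lambda>ds Y. FEF Y) ?P [2, 2] (x_state x y \<alpha> \<beta> \<omega>) = ?v"
    using le[OF mem] by linarith
  then have "?v \<in> ?V"
    using mem by (simp only:)
  then show ?thesis
    unfolding Fstar_def by (rule cSup_eq_maximum) (rule le)
qed

text \<open>Once the middle nodes have dimension 1 the partial trace merely relabels indices, with B
  moving from position 3 to 1.\<close>

lemma reduce_AB_apply_local:
  "reduce_AB [2, 1, 1, 2] (apply_local [2, 1, 1, 2] 0 K X) = apply_local [2, 2] 0 K (reduce_AB [2, 1, 1, 2] X)"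
  "reduce_AB [2, 1, 1, 2] (apply_local [2, 1, 1, 2] 3 K X) = apply_local [2, 2] 1 K (reduce_AB [2, 1, 1, 2] X)"
proof -
  have "(ix4 a c e b)(0 := a') = ix4 a' c e b" "(ix4 a c e b)(3 := b') = ix4 a c e b'" for a b c e a' b'
    by (auto simp: ix4_def fun_eq_iff)
  moreover have "ix4 a c e b 0 = a" "ix4 a c e b 3 = b" for a b c e
    by (simp_all add: ix4_def)
  ultimately show
    "reduce_AB [2, 1, 1, 2] (apply_local [2, 1, 1, 2] 0 K X) = apply_local [2, 2] 0 K (reduce_AB [2, 1, 1, 2] X)"
    "reduce_AB [2, 1, 1, 2] (apply_local [2, 1, 1, 2] 3 K X) = apply_local [2, 2] 1 K (reduce_AB [2, 1, 1, 2] X)"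
    by (auto simp: reduce_AB_def apply_local_def intro!: ext)
qed

lemma reduce_AB_add:
  "reduce_AB ds (\<lambda>i i'. X i i' + Y i i') = (\<lambda>i i'. reduce_AB ds X i i' + reduce_AB ds Y i i')"
  by (simp add: reduce_AB_def sum.distrib)

lemma pval_filter_protocol_reduce:
  "pval (\<lambda>ds Y. FEF (reduce_AB ds Y)) (filter_protocol x y t 3) [2, 1, 1, 2] X
     = pval (\<lambda>ds Y. FEF Y) (filter_protocol x y t 1) [2, 2] (reduce_AB [2, 1, 1, 2] X)"
proof -
  have "[2, 1, 1, 2][3 := 2] = [2, 1, 1, 2 :: nat]" by (simp add: eval_nat_numeral)
  then show ?thesis
    by (simp add: filter_protocol_def reduce_AB_apply_local reduce_AB_add
        reduce_AB_apply_local[simplified])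
qed

section \<open>Bell measurements\<close>

text \<open>A Bell outcome is a bra, hence a Kraus operator with output dimension 1: the node's
  qubits are consumed. The continuation may depend on both outcomes.\<close>

definition bell_protocol :: "(nat \<Rightarrow> nat \<Rightarrow> protocol) \<Rightarrow> protocol" where
  "bell_protocol Q = Step 2 (map (\<lambda>k2. (1, [\<lambda>_ e. cnj (bell k2 e)],
     Step 1 (map (\<lambda>k1. (1, [\<lambda>_ c. cnj (bell k1 c)], Q k1 k2)) [0, 1, 2, 3]))) [0, 1, 2, 3])"

lemma bell_completeness:
  assumes "c < 4" "c' < 4"
  shows "(\<Sum>k\<leftarrow>[0, 1, 2, 3]. bell k c * cnj (bell k c')) = (if c = c' then 1 else 0)"
proof -
  have "complex_of_real (1 / sqrt 2) * complex_of_real (1 / sqrt 2) = 1/2"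
    by (simp only: of_real_mult[symmetric]) simp
  moreover have "c \<in> {0, 1, 2, 3}" "c' \<in> {0, 1, 2, 3}"
    using assms by auto
  ultimately show ?thesis
    unfolding bell_def by (auto simp: algebra_simps)
qed

lemma valid_bell_protocol:
  assumes "\<And>k1 k2. k1 < 4 \<Longrightarrow> k2 < 4 \<Longrightarrow> valid ok (Q k1 k2) [2, 1, 1, 2]"
  shows "valid ok (bell_protocol Q) [2, 4, 4, 2]"
proof -
  have tp: "trace_pres 4 (map (\<lambda>k. (1, [\<lambda>_ c. cnj (bell k c)], R k)) [0, 1, 2, 3])" for R
    unfolding trace_pres_def using bell_completeness by (simp add: comp_def)
  have "trace_pres 4 (map (\<lambda>k1. (1, [\<lambda>_ c. cnj (bell k1 c)], Q k1 k2)) [0, 1, 2, 3])" for k2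
    by (rule tp)
  with tp show ?thesis
    unfolding bell_protocol_def using assms by (simp add: eval_nat_numeral)
qed

lemma reduce_bell:
  "reduce_AB [2, 1, 1, 2] (apply_local [2, 4, 1, 2] 1 (\<lambda>_ c. cnj (bell k1 c))
     (apply_local [2, 4, 4, 2] 2 (\<lambda>_ e. cnj (bell k2 e)) X)) = cond_AB X k1 k2"
proof -
  have "(ix4 a c e b)(Suc 0 := c') = ix4 a c' e b" "(ix4 a c e b)(2 := e') = ix4 a c e' b" for a b c e c' e'
    by (auto simp: ix4_def fun_eq_iff)
  then have 1: "apply_local [2, 4, 1, 2] 1 (\<lambda>_ c. cnj (bell k1 c)) Y (ix4 a 0 0 b) (ix4 a' 0 0 b') =
      (\<Sum>c<4. \<Sum>c'<4. cnj (bell k1 c) * Y (ix4 a c 0 b) (ix4 a' c' 0 b') * bell k1 c')"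
    and 2: "apply_local [2, 4, 4, 2] 2 (\<lambda>_ e. cnj (bell k2 e)) X (ix4 a c 0 b) (ix4 a' c' 0 b') =
      (\<Sum>e<4. \<Sum>e'<4. cnj (bell k2 e) * X (ix4 a c e b) (ix4 a' c' e' b') * bell k2 e')" for Y a b c a' b' c'
    by (simp_all add: apply_local_def)
  have r: "reduce_AB [2, 1, 1, 2] Y i i' = Y (ix4 (i 0) 0 0 (i 1)) (ix4 (i' 0) 0 0 (i' 1))" for Y i i'
    by (simp add: reduce_AB_def)
  show ?thesis
    unfolding fun_eq_iff r 1 2 cond_AB_def by (simp add: sum_distrib_left sum_distrib_right mult_ac)
qed

lemma pval_bell_protocol:
  "pval (\<lambda>ds Y. FEF (reduce_AB ds Y)) (bell_protocol (\<lambda>k1 k2. filter_protocol (x k1 k2) (y k1 k2) (t k1 k2) 3)) [2, 4, 4, 2] X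
   = (\<Sum>k1<4. \<Sum>k2<4. pval (\<lambda>ds Y. FEF Y) (filter_protocol (x k1 k2) (y k1 k2) (t k1 k2) 1) [2, 2] (cond_AB X k1 k2))"
proof -
  have "[2, 4, 4, 2][2 := 1] = [2, 4, 1, 2 :: nat]" "[2, 4, 1, 2][1 := 1] = [2, 1, 1, 2 :: nat]"
    by (simp_all add: eval_nat_numeral)
  then show ?thesis
    \<comment> \<open>N2 measures first, so the tree sums over \<open>k2\<close> on the
      outside.\<close>
    apply (subst sum.swap)
    apply (simp only: bell_protocol_def pval.simps list.map sum_list.Cons sum_list.Nil fst_conv snd_conv
        add_0_right pval_filter_protocol_reduce reduce_bell sum_lessThan_4 add.assoc)
    done
qed


section \<open>Entanglement swapping: the conditional states\<close>

definition bell_flip :: "nat \<Rightarrow> nat" where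
  "bell_flip k = (if k < 2 then 0 else 1)"

text \<open>Amplitudes with which the ancilla and the Bell outcome \<open>k\<close> carry level \<open>z\<close> of the middle
  segment to an end party. The two sides differ only in the sign for the singlet outcome.\<close>
definition left_coeff :: "real \<Rightarrow> nat \<Rightarrow> nat \<Rightarrow> real" where
  "left_coeff q k z = 1 / sqrt 2 *
     (if k = 0 then (if z = 0 then sqrt q else sqrt (1 - q))
      else if k = 1 then (if z = 0 then sqrt q else - sqrt (1 - q))
      else if k = 2 then (if z = 0 then sqrt (1 - q) else sqrt q)
      else (if z = 0 then - sqrt (1 - q) else sqrt q))"

definition right_coeff :: "real \<Rightarrow> nat \<Rightarrow> nat \<Rightarrow> real" where
  "right_coeff q k z = 1 / sqrt 2 *
     (if k = 0 then (if z = 0 then sqrt q else sqrt (1 - q))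
      else if k = 1 then (if z = 0 then sqrt q else - sqrt (1 - q))
      else if k = 2 then (if z = 0 then sqrt (1 - q) else sqrt q)
      else (if z = 0 then sqrt (1 - q) else - sqrt q))"

lemma bell_contract_left:
  assumes "k < 4"
  shows "(\<Sum>c<4. cnj (bell k c) * psi_st q a (c div 2) * h (c mod 2)) =
     (if a = bell_flip k then of_real (left_coeff q k 0) * h 0
      else if a = 1 - bell_flip k then of_real (left_coeff q k 1) * h 1 else 0)"
proof -
  have "k \<in> {0, 1, 2, 3}" using assms by auto
  then show ?thesis
    by (auto simp: sum_lessThan_4 bell_def psi_st_def left_coeff_def bell_flip_def)
qed

lemma bell_contract_right:
  assumes "k < 4"
  shows "(\<Sum>e<4. cnj (bell k e) * psi_st q (e mod 2) b * h (e div 2)) =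
     (if b = bell_flip k then of_real (right_coeff q k 0) * h 0
      else if b = 1 - bell_flip k then of_real (right_coeff q k 1) * h 1 else 0)"
proof -
  have "k \<in> {0, 1, 2, 3}" using assms by auto
  then show ?thesis
    by (auto simp: sum_lessThan_4 bell_def psi_st_def right_coeff_def bell_flip_def)
qed

lemma bell_contract_link_vec:
  assumes "k1 < 4" "k2 < 4"
  shows "(\<Sum>c<4. \<Sum>e<4. cnj (bell k1 c) * cnj (bell k2 e) * link_vec al ar h (ix4 a c e b)) =
    (if a = bell_flip k1 then of_real (left_coeff al k1 0) *
        (if b = bell_flip k2 then of_real (right_coeff ar k2 0) * h 0 0
         else if b = 1 - bell_flip k2 then of_real (right_coeff ar k2 1) * h 0 1 else 0)
     else if a = 1 - bell_flip k1 then of_real (left_coeff al k1 1) *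
        (if b = bell_flip k2 then of_real (right_coeff ar k2 0) * h 1 0
         else if b = 1 - bell_flip k2 then of_real (right_coeff ar k2 1) * h 1 1 else 0)
     else 0)"
proof -
  have "(\<Sum>c<4. \<Sum>e<4. cnj (bell k1 c) * cnj (bell k2 e) * link_vec al ar h (ix4 a c e b)) =
    (\<Sum>c<4. cnj (bell k1 c) * psi_st al a (c div 2) *
       (\<Sum>e<4. cnj (bell k2 e) * psi_st ar (e mod 2) b * h (c mod 2) (e div 2)))"
    by (simp add: link_vec_def ix4_def sum_distrib_left mult_ac)
  then show ?thesis
    \<comment> \<open>The right contraction, as a function of the left level \<open>z\<close> of the
      middle segment, becomes the \<open>h\<close> of the left contraction.\<close>
    unfolding bell_contract_right[OF assms(2)]
      bell_contract_left[OF assms(1), where h = "\<lambda>z. if b = bell_flip k2 then of_real (right_coeff ar k2 0) * h z 0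
         else if b = 1 - bell_flip k2 then of_real (right_coeff ar k2 1) * h z 1 else 0"] .
qed

lemma cond_AB_opsum:
  "cond_AB (opsum L) k1 k2 =
     opsum (map (\<lambda>u i. \<Sum>c<4. \<Sum>e<4. cnj (bell k1 c) * cnj (bell k2 e) * u (ix4 (i 0) c e (i 1))) L)"
proof (induction L)
  case Nil
  show ?case by (simp add: opsum_Nil cond_AB_def)
next
  case (Cons u L)
  let ?S = "\<lambda>i. \<Sum>c<4. \<Sum>e<4. cnj (bell k1 c) * cnj (bell k2 e) * u (ix4 (i 0) c e (i 1))"
  have 1: "cond_AB (\<lambda>i i'. u i * cnj (u i') + opsum L i i') k1 k2 i i'
     = (\<Sum>c<4. \<Sum>c'<4. \<Sum>e<4. \<Sum>e'<4. (cnj (bell k1 c) * cnj (bell k2 e) * u (ix4 (i 0) c e (i 1)))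
         * cnj (cnj (bell k1 c') * cnj (bell k2 e') * u (ix4 (i' 0) c' e' (i' 1))))
       + cond_AB (opsum L) k1 k2 i i'" for i i'
    by (simp add: cond_AB_def sum.distrib algebra_simps)
  have 2: "(\<Sum>c<4. \<Sum>c'<4. \<Sum>e<4. \<Sum>e'<4. (cnj (bell k1 c) * cnj (bell k2 e) * u (ix4 (i 0) c e (i 1)))
         * cnj (cnj (bell k1 c') * cnj (bell k2 e') * u (ix4 (i' 0) c' e' (i' 1))))
     = ?S i * cnj (?S i')" for i i'
    unfolding cnj_sum by (simp only: sum_product)
  show ?case
    unfolding opsum_Cons list.map fun_eq_iff 1 2 Cons.IH by simp
qed

text \<open>Swapping only rescales amplitudes and relabels levels. The noise vector has left level 0
  and right level 1, which explains the mixed coefficients in the third amplitude.\<close>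

lemma cond_AB_rep_init:
  assumes "0 \<le> p" "p \<le> 1" "k1 < 4" "k2 < 4"
  shows "cond_AB (rep_init al p \<delta> ar) k1 k2 = x_state (bell_flip k1) (bell_flip k2)
     (left_coeff al k1 0 * right_coeff ar k2 0 * (sqrt (1 - p) * sqrt \<delta>))
     (left_coeff al k1 1 * right_coeff ar k2 1 * (sqrt (1 - p) * sqrt (1 - \<delta>)))
     (left_coeff al k1 0 * right_coeff ar k2 1 * sqrt p)"
proof -
  have "bell_flip k1 \<noteq> 1 - bell_flip k1" "bell_flip k2 \<noteq> 1 - bell_flip k2"
    by (auto simp: bell_flip_def)
  then show ?thesis
    unfolding rep_init_link_vec[OF assms(1,2)] cond_AB_opsum x_state_def list.map bell_contract_link_vec[OF assms(3,4)]
    by (intro arg_cong[where f = opsum]) (auto simp: corr_vec_def unit_vec_def fun_eq_iff)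
qed

text \<open>Averaging over outcomes restores the weights of the middle segment: for a fixed level,
  two outcomes contribute \<open>q / 2\<close> each and two \<open>(1 - q) / 2\<close> each.\<close>

lemma coeff_weights:
  assumes "0 \<le> q" "q \<le> 1"
  shows "(\<Sum>k<4. (left_coeff q k 0)\<^sup>2) = 1" "(\<Sum>k<4. (left_coeff q k 1)\<^sup>2) = 1"
    "(\<Sum>k<4. (right_coeff q k 0)\<^sup>2) = 1" "(\<Sum>k<4. (right_coeff q k 1)\<^sup>2) = 1"
  using assms by (simp_all add: sum_lessThan_4 left_coeff_def right_coeff_def power_divide)

text \<open>The filter strength of an outcome contains the left ratio of level 1 to 0 and the right
  ratio of level 0 to 1. Squared, each is \<open>q / (1 - q)\<close> or its inverse, and the former
  is larger as \<open>q\<close> is at least one half.\<close>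

lemma coeff_ratio:
  assumes "1/2 \<le> q" "q < 1"
  shows "(left_coeff q k 1)\<^sup>2 * (1 - q) \<le> (left_coeff q k 0)\<^sup>2 * q" "left_coeff q k 0 \<noteq> 0"
    "(right_coeff q k 0)\<^sup>2 * (1 - q) \<le> (right_coeff q k 1)\<^sup>2 * q" "right_coeff q k 1 \<noteq> 0"
proof -
  have "(1 - q) * (1 - q) \<le> q * q" using assms by (intro mult_mono) auto
  then show "(left_coeff q k 1)\<^sup>2 * (1 - q) \<le> (left_coeff q k 0)\<^sup>2 * q" "left_coeff q k 0 \<noteq> 0"
    "(right_coeff q k 0)\<^sup>2 * (1 - q) \<le> (right_coeff q k 1)\<^sup>2 * q" "right_coeff q k 1 \<noteq> 0"
    using assms by (auto simp: left_coeff_def right_coeff_def power_divide)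
qed

text \<open>Multiplying the two worst-case ratios and chaining with the assumption on the segments
  gives the filter condition of a single outcome; the positive factor \<open>b * d\<close>
  cancels.\<close>

lemma condition_transfer:
  fixes l0 l1 r0 r1 :: real
  assumes "0 < b" "0 < d" "0 \<le> x" "a * c * x \<le> b * d * w" "0 \<le> a" "0 \<le> c"
    and "l1\<^sup>2 * b \<le> l0\<^sup>2 * a" "r0\<^sup>2 * d \<le> r1\<^sup>2 * c"
  shows "l1\<^sup>2 * r0\<^sup>2 * x \<le> l0\<^sup>2 * r1\<^sup>2 * w"
proof -
  have "(l1\<^sup>2 * b) * (r0\<^sup>2 * d) \<le> (l0\<^sup>2 * a) * (r1\<^sup>2 * c)"
    by (rule mult_mono) (use assms in auto)
  then have "((l1\<^sup>2 * b) * (r0\<^sup>2 * d)) * x \<le> ((l0\<^sup>2 * a) * (r1\<^sup>2 * c)) * x"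
    using assms(3) by (rule mult_right_mono)
  also have "\<dots> = (l0\<^sup>2 * r1\<^sup>2) * (a * c * x)" by (simp add: mult_ac)
  also have "\<dots> \<le> (l0\<^sup>2 * r1\<^sup>2) * (b * d * w)"
    using assms(4) by (intro mult_left_mono) auto
  finally have "(b * d) * (l1\<^sup>2 * r0\<^sup>2 * x) \<le> (b * d) * (l0\<^sup>2 * r1\<^sup>2 * w)"
    by (simp add: mult_ac)
  then show ?thesis
    using assms(1,2) by simp
qed

section \<open>Optimality of the Bell measurement protocol\<close>

theorem theorem2:
  fixes p \<delta> al ar :: real
  assumes "0 < p" "p < 1"
    and "1/2 \<le> \<delta>" "\<delta> < 1"
    and "1/2 \<le> al" "al < 1"
    and "1/2 \<le> ar" "ar < 1"
    and "(al * ar) / ((1 - al) * (1 - ar)) \<le> p^2 / (\<delta> * (1 - \<delta>) * (1 - p)^2)"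
  shows "(\<Sum>k1<4. \<Sum>k2<4. Fstar (cond_AB (rep_init al p \<delta> ar) k1 k2)) = Fstar (rho_op p \<delta>)
       \<and> Fstar_AB (rep_init al p \<delta> ar) = Fstar (rho_op p \<delta>)"
proof -
  let ?X = "rep_init al p \<delta> ar"
  define \<alpha> \<beta> \<omega> where "\<alpha> = sqrt (1 - p) * sqrt \<delta>" and "\<beta> = sqrt (1 - p) * sqrt (1 - \<delta>)" and "\<omega> = sqrt p"
  define l r where "l = left_coeff al" and "r = right_coeff ar"
  define A B W where "A k1 k2 = l k1 0 * r k2 0 * \<alpha>" and "B k1 k2 = l k1 1 * r k2 1 * \<beta>"
    and "W k1 k2 = l k1 0 * r k2 1 * \<omega>" for k1 k2
  define V where "V = 1/2 * (1 + (1 - p)\<^sup>2 * \<delta> * (1 - \<delta>) / p)"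
  have \<omega>: "\<omega> \<noteq> 0" using assms by (simp add: \<omega>_def)
  have sq: "\<alpha>\<^sup>2 = (1 - p) * \<delta>" "\<beta>\<^sup>2 = (1 - p) * (1 - \<delta>)" "\<omega>\<^sup>2 = p"
    using assms by (simp_all add: \<alpha>_def \<beta>_def \<omega>_def power_mult_distrib)
  have \<omega>4: "\<omega> ^ 4 = p\<^sup>2"
    using sq(3) by (metis mult_2 numeral_Bit0 power_add power2_eq_square)
  have cond: "al * ar * (\<alpha>\<^sup>2 * \<beta>\<^sup>2) \<le> (1 - al) * (1 - ar) * p\<^sup>2"
  proof -
    have "0 < (1 - al) * (1 - ar)" "0 < \<delta> * (1 - \<delta>) * (1 - p)\<^sup>2"
      using assms by simp_all
    then have "al * ar * (\<delta> * (1 - \<delta>) * (1 - p)\<^sup>2) \<le> p\<^sup>2 * ((1 - al) * (1 - ar))"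
      using assms(9) by (simp only: frac_le_eq divide_le_eq pos_le_divide_eq pos_divide_le_eq times_divide_eq_left)
    then show ?thesis
      unfolding sq by (simp add: power2_eq_square mult_ac)
  qed
  have val: "1/2 * (\<alpha>\<^sup>2 + \<beta>\<^sup>2 + \<omega>\<^sup>2 + \<alpha>\<^sup>2 * \<beta>\<^sup>2 / \<omega>\<^sup>2) = V"
    unfolding sq V_def by (simp add: power2_eq_square algebra_simps)
  \<comment> \<open>The same transfer with all coefficients 1, possible because \<open>al\<close>
    and \<open>ar\<close> are at least one half: the direct segment then lies in the same
    regime.\<close>
  have le4: "\<alpha>\<^sup>2 * \<beta>\<^sup>2 \<le> \<omega> ^ 4"
    using condition_transfer[OF _ _ _ cond, of 1 1 1 1] assms unfolding \<omega>4 by simp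
  have rho: "Fstar (rho_op p \<delta>) = V"
    using assms Fstar_x_state[OF _ _ \<omega> le4, of 0 0]
    by (simp only: rho_op_x_state[of p \<delta>] less_imp_le \<alpha>_def[symmetric] \<beta>_def[symmetric] \<omega>_def[symmetric] val)
  have W: "W k1 k2 \<noteq> 0" for k1 k2
    using coeff_ratio[of al] coeff_ratio[of ar] assms \<omega> by (simp add: W_def l_def r_def)
  have AB: "(A k1 k2)\<^sup>2 * (B k1 k2)\<^sup>2 \<le> W k1 k2 ^ 4" for k1 k2
  proof -
    have "(l k1 1)\<^sup>2 * (r k2 0)\<^sup>2 * (\<alpha>\<^sup>2 * \<beta>\<^sup>2) \<le> (l k1 0)\<^sup>2 * (r k2 1)\<^sup>2 * p\<^sup>2"
      unfolding l_def r_def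
      by (rule condition_transfer[OF _ _ _ cond]) (use assms coeff_ratio in auto)
    \<comment> \<open>The multiplier is the common factor of
      \<open>(A k1 k2)\<^sup>2 * (B k1 k2)\<^sup>2\<close> and \<open>W k1 k2 ^ 4\<close>.\<close>
    then have "((l k1 0)\<^sup>2 * (r k2 1)\<^sup>2) * ((l k1 1)\<^sup>2 * (r k2 0)\<^sup>2 * (\<alpha>\<^sup>2 * \<beta>\<^sup>2))
        \<le> ((l k1 0)\<^sup>2 * (r k2 1)\<^sup>2) * ((l k1 0)\<^sup>2 * (r k2 1)\<^sup>2 * p\<^sup>2)"
      by (rule mult_left_mono) simp
    then show ?thesis
      unfolding \<omega>4[symmetric]
      by (simp add: A_def B_def W_def power_mult_distrib mult_ac power2_eq_square[of "_ * _"] power4_eq_xxxx power2_eq_square)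
  qed
  have cAB: "cond_AB ?X k1 k2 = x_state (bell_flip k1) (bell_flip k2) (A k1 k2) (B k1 k2) (W k1 k2)"
    if "k1 < 4" "k2 < 4" for k1 k2
    using assms cond_AB_rep_init[OF _ _ that, of p]
    by (simp add: A_def B_def W_def l_def r_def \<alpha>_def \<beta>_def \<omega>_def)
  let ?v = "\<lambda>k1 k2. 1/2 * ((A k1 k2)\<^sup>2 + (B k1 k2)\<^sup>2 + (W k1 k2)\<^sup>2 + (A k1 k2)\<^sup>2 * (B k1 k2)\<^sup>2 / (W k1 k2)\<^sup>2)"
  have bf: "bell_flip k < 2" for k by (simp add: bell_flip_def)
  have sum_v: "(\<Sum>k1<4. \<Sum>k2<4. ?v k1 k2) = V"
  proof -
    have l0: "l k1 0 \<noteq> 0" and r1: "r k2 1 \<noteq> 0" for k1 k2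
      using W[of k1 k2] by (auto simp: W_def)
    \<comment> \<open>In the last quotient the factors \<open>(l k1 0)\<^sup>2\<close> and
      \<open>(r k2 1)\<^sup>2\<close> cancel. Every term becomes a left weight times a right weight,
      and by \<open>coeff_weights\<close> each weight sums to 1 over the outcomes.\<close>
    have v: "?v k1 k2 = 1/2 * ((l k1 0)\<^sup>2 * (r k2 0)\<^sup>2 * \<alpha>\<^sup>2 + (l k1 1)\<^sup>2 * (r k2 1)\<^sup>2 * \<beta>\<^sup>2
        + (l k1 0)\<^sup>2 * (r k2 1)\<^sup>2 * \<omega>\<^sup>2 + (l k1 1)\<^sup>2 * (r k2 0)\<^sup>2 * (\<alpha>\<^sup>2 * \<beta>\<^sup>2 / \<omega>\<^sup>2))" for k1 k2
      using l0[of k1] r1[of k2] \<omega> by (simp add: A_def B_def W_def power_mult_distrib field_simps)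
    have s: "(\<Sum>k1<4. \<Sum>k2<4. (f k1)\<^sup>2 * (g k2)\<^sup>2 * c) = (\<Sum>k1<4. (f k1)\<^sup>2) * (\<Sum>k2<4. (g k2)\<^sup>2) * c"
      for f g :: "nat \<Rightarrow> real" and c
      unfolding sum_product by (simp only: sum_distrib_right)
    have "(\<Sum>k1<4. \<Sum>k2<4. ?v k1 k2) = 1/2 * (\<alpha>\<^sup>2 + \<beta>\<^sup>2 + \<omega>\<^sup>2 + \<alpha>\<^sup>2 * \<beta>\<^sup>2 / \<omega>\<^sup>2)"
      unfolding v sum_distrib_left[symmetric] sum.distrib s
      using assms by (simp add: l_def r_def coeff_weights coeff_weights[unfolded One_nat_def])
    then show ?thesis unfolding val .
  qed
  have part1: "(\<Sum>k1<4. \<Sum>k2<4. Fstar (cond_AB ?X k1 k2)) = V"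
  proof -
    have "(\<Sum>k1<4. \<Sum>k2<4. Fstar (cond_AB ?X k1 k2)) = (\<Sum>k1<4. \<Sum>k2<4. ?v k1 k2)"
      by (intro sum.cong refl) (simp only: lessThan_iff cAB Fstar_x_state[OF bf bf W AB])
    then show ?thesis unfolding sum_v .
  qed
  \<comment> \<open>Each pair of outcomes gets the filter that is optimal for its own conditional
    state.\<close>
  define t where "t k1 k2 = A k1 k2 * B k1 k2 / (W k1 k2)\<^sup>2" for k1 k2
  note t = filter_strength[OF W AB, folded t_def]
  let ?P = "bell_protocol (\<lambda>k1 k2. filter_protocol (bell_flip k1) (bell_flip k2) (t k1 k2) 3)"
  let ?S = "{pval (\<lambda>ds Y. FEF (reduce_AB ds Y)) P [2, 4, 4, 2] ?X | P. valid rep_ok P [2, 4, 4, 2]}"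
  have le: "v \<le> V" if "v \<in> ?S" for v
    using that assms pval_rep_init_le[of _ p \<delta> al ar] by (auto simp: V_def)
  have "valid rep_ok ?P [2, 4, 4, 2]"
    by (intro valid_bell_protocol valid_filter_protocol bf t) (simp_all add: rep_ok_def eval_nat_numeral)
  then have mem: "pval (\<lambda>ds Y. FEF (reduce_AB ds Y)) ?P [2, 4, 4, 2] ?X \<in> ?S"
    by blast
  have "V \<le> pval (\<lambda>ds Y. FEF (reduce_AB ds Y)) ?P [2, 4, 4, 2] ?X"
    unfolding pval_bell_protocol sum_v[symmetric]
  proof (intro sum_mono)
    fix k1 k2 :: nat assume "k1 \<in> {..<4}" "k2 \<in> {..<4}"
    then show "?v k1 k2 \<le> pval (\<lambda>ds Y. FEF Y) (filter_protocol (bell_flip k1) (bell_flip k2) (t k1 k2) 1) [2, 2] (cond_AB ?X k1 k2)"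
      using pval_filter_protocol_ge[OF bf[of k1] bf[of k2] t(1)[of k1 k2], of "A k1 k2" "B k1 k2" "W k1 k2"] t(2)[of k1 k2]
      by (simp add: cAB)
  qed
  then have "pval (\<lambda>ds Y. FEF (reduce_AB ds Y)) ?P [2, 4, 4, 2] ?X = V"
    using le[OF mem] by linarith
  then have "V \<in> ?S"
    using mem by (simp only:)
  then have "Fstar_AB ?X = V"
    unfolding Fstar_AB_def by (rule cSup_eq_maximum) (rule le)
  then show ?thesis
    using part1 rho by simp
qed

end
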